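(* Let $(X_k)_{k\ge1}$ be a Markov chain on a finite state space $E$ whose transition matrix $P=(p_{ij})$ is irreducible and aperiodic and reversible with respect to its stationary distribution $\pi$, i.e. $\pi_i p_{ij}=\pi_j p_{ji}$ for all $i,j\in E$. Assume the chain is in the stationary state ($X_1\sim\pi$). Let $\lambda$ be the second largest eigenvalue of $P$ and put $\lambda_0=\max(0,\lambda)$. Let $f:E\to[0,1]$, let $\mu=\mathbb{E}_\pi[f(X_k)]$ with $0<\mu<1$, write $\bar\mu=1-\mu$, and let $S_n=\sum_{k=1}^n f(X_k)$. Then for every $\varepsilon>0$ with $\mu+\varepsilon<1$ and every $n\ge1$, $$\mathbb{P}_\pi[S_n\ge n(\mu+\varepsilon)]\le\left[\frac{\mu+\bar\mu\lambda_0}{1-2(\bar\mu-\varepsilon)/(1+\sqrt\Delta)}\right]^{n(\mu+\varepsilon)}\left[\frac{\bar\mu+\mu\lambda_0}{1-2(\mu+\varepsilon)/(1+\sqrt\Delta)}\right]^{n(\bar\mu-\varepsilon)}\le\exp\Big\{-2\,\frac{1-\lambda_0}{1+\lambda_0}\,n\varepsilon^2\Big\},$$ where $$\Delta=1+\frac{4\lambda_0(\mu+\varepsilon)(\bar\mu-\varepsilon)}{\mu\bar\mu(1-\lambda_0)^2}.$$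
   Context: Reversibility implies all eigenvalues of $P$ are real; list them as $1=\lambda_1>\lambda_2\ge\lambda_3\ge\cdots$ (with multiplicity), and the "second largest eigenvalue" is $\lambda=\lambda_2$. $\mathbb{P}_\pi$ denotes probability for the chain started from its stationary distribution $\pi$. *)

theory Defs
  imports "HOL-Analysis.Analysis" "HOL-Computational_Algebra.Polynomial" "HOL-Library.Multiset"
begin

primrec mpow :: "real^'s^'s \<Rightarrow> nat \<Rightarrow> real^'s^'s" where
  "mpow P 0 = mat 1"
| "mpow P (Suc n) = mpow P n ** P"

definition stochastic :: "real^'s^'s \<Rightarrow> bool" where
  "stochastic P \<longleftrightarrow> (\<forall>i j. P $ i $ j \<ge> 0) \<and> (\<forall>i. (\<Sum>j\<in>UNIV. P $ i $ j) = 1)"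

definition irreducible_chain :: "real^'s^'s \<Rightarrow> bool" where
  "irreducible_chain P \<longleftrightarrow> (\<forall>i j. \<exists>n. mpow P n $ i $ j > 0)"

definition aperiodic_chain :: "real^'s^'s \<Rightarrow> bool" where
  "aperiodic_chain P \<longleftrightarrow> (\<forall>i. Gcd {n. n \<ge> 1 \<and> mpow P n $ i $ i > 0} = 1)"

definition prob_vector :: "('s \<Rightarrow> real) \<Rightarrow> bool" where
  "prob_vector \<pi> \<longleftrightarrow> (\<forall>i. \<pi> i \<ge> 0) \<and> (\<Sum>i\<in>UNIV. \<pi> i) = 1"

definition stationary :: "real^'s^'s \<Rightarrow> ('s \<Rightarrow> real) \<Rightarrow> bool" where
  "stationary P \<pi> \<longleftrightarrow> prob_vector \<pi> \<and> (\<forall>j. (\<Sum>i\<in>UNIV. \<pi> i * P $ i $ j) = \<pi> j)"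

definition reversible :: "real^'s^'s \<Rightarrow> ('s \<Rightarrow> real) \<Rightarrow> bool" where
  "reversible P \<pi> \<longleftrightarrow> (\<forall>i j. \<pi> i * P $ i $ j = \<pi> j * P $ j $ i)"

definition char_poly_mat :: "real^'s^'s \<Rightarrow> real poly" where
  "char_poly_mat P = det (\<chi> i j. (if i = j then [:0, 1:] else 0) - [:P $ i $ j:])"

text \<open>Eigenvalues with (algebraic) multiplicity, listed in decreasing order
  (they are all real for a reversible chain).\<close>
definition eigenvalues_desc :: "real^'s^'s \<Rightarrow> real list" where
  "eigenvalues_desc P = rev (sorted_list_of_multiset (proots (char_poly_mat P)))"

definition second_eigenvalue :: "real^'s^'s \<Rightarrow> real" where
  "second_eigenvalue P = eigenvalues_desc P ! 1"

definition path_prob :: "real^'s^'s \<Rightarrow> ('s \<Rightarrow> real) \<Rightarrow> 's list \<Rightarrow> real" where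
  "path_prob P \<pi> xs = \<pi> (xs ! 0) * (\<Prod>k<length xs - 1. P $ (xs ! k) $ (xs ! Suc k))"

definition path_event_prob :: "real^'s^'s \<Rightarrow> ('s \<Rightarrow> real) \<Rightarrow> nat \<Rightarrow> ('s list \<Rightarrow> bool) \<Rightarrow> real" where
  "path_event_prob P \<pi> n A = (\<Sum>xs\<in>{xs. length xs = n \<and> A xs}. path_prob P \<pi> xs)"

end

theory Submission
  imports Defs
begin

text \<open>
  In the inner product of \<open>L\<^sup>2(\<pi>)\<close> the spectral gap says that \<open>P\<close> is dominated, as a quadratic form, by
  \<open>Q = \<lambda>\<^sub>0 I + (1 - \<lambda>\<^sub>0) 1 \<pi>\<^sup>T\<close>. The exponential moment of \<open>S\<^sub>n\<close> is a matrix element of a power of the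
  tilted operator \<open>D\<^sup>1\<^sup>/\<^sup>2 P D\<^sup>1\<^sup>/\<^sup>2\<close> with \<open>D = exp (\<theta> f)\<close>, which is nonnegative and self-adjoint, so it is at most
  \<open>\<rho>\<^sup>n\<close> for every \<open>\<rho>\<close> bounding \<open>D\<^sup>1\<^sup>/\<^sup>2 Q D\<^sup>1\<^sup>/\<^sup>2\<close> from above. Cauchy--Schwarz turns the latter into a scalar
  condition that is convex in \<open>f\<close>, hence worst when \<open>f\<close> takes only the values 0 and 1. This is the
  characteristic equation of a tilted two-state chain, and the optimal \<open>\<theta>\<close> gives the first bound.
  For the second, the exponent of the first bound is a relative entropy rate of two-state chains; by
  duality any tilt bounds it, and a Gaussian-type tilt reduces the claim to one inequality between
  hyperbolic functions.
\<close>

section \<open>A hyperbolic inequality\<close>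

lemma sinh_le_mult_cosh:
  fixes x :: real assumes "0 \<le> x" shows "sinh x \<le> x * cosh x"
proof -
  have "(\<lambda>x. x * cosh x - sinh x) 0 \<le> (\<lambda>x. x * cosh x - sinh x) x"
  proof (rule DERIV_nonneg_imp_nondecreasing[OF assms])
    fix y :: real assume y: "0 \<le> y" "y \<le> x"
    show "\<exists>d. ((\<lambda>x. x * cosh x - sinh x) has_real_derivative d) (at y) \<and> 0 \<le> d"
      using y by (intro exI[of _ "y * sinh y"] conjI) (auto intro!: derivative_eq_intros)
  qed
  then show ?thesis by simp
qed

lemma real_le_sinh:
  fixes x :: real assumes "0 \<le> x" shows "x \<le> sinh x"
proof -
  have "(\<lambda>x. sinh x - x) 0 \<le> (\<lambda>x. sinh x - x) x"
  proof (rule DERIV_nonneg_imp_nondecreasing[OF assms])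
    fix y :: real assume "0 \<le> y" "y \<le> x"
    show "\<exists>d. ((\<lambda>x. sinh x - x) has_real_derivative d) (at y) \<and> 0 \<le> d"
      using cosh_real_ge_1[of y]
      by (intro exI[of _ "cosh y - 1"] conjI) (auto intro!: derivative_eq_intros)
  qed
  then show ?thesis by simp
qed

lemma cosh_minus_1_le:
  fixes x :: real assumes "0 \<le> x" shows "cosh x - 1 \<le> x / 2 * sinh x"
proof -
  have "(\<lambda>x. x / 2 * sinh x - cosh x) 0 \<le> (\<lambda>x. x / 2 * sinh x - cosh x) x"
  proof (rule DERIV_nonneg_imp_nondecreasing[OF assms])
    fix y :: real assume y: "0 \<le> y" "y \<le> x"
    show "\<exists>d. ((\<lambda>x. x / 2 * sinh x - cosh x) has_real_derivative d) (at y) \<and> 0 \<le> d"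
      using sinh_le_mult_cosh[OF y(1)]
      by (intro exI[of _ "(y * cosh y - sinh y) / 2"] conjI)
        (auto intro!: derivative_eq_intros simp: field_simps)
  qed
  then show ?thesis by simp
qed

lemma cosh_le_5:
  fixes x :: real assumes "0 \<le> x" "x \<le> 2" shows "cosh x \<le> 5"
proof -
  have "exp 2 = exp 1 * (exp 1 :: real)" by (simp flip: exp_add)
  also have "\<dots> \<le> 272/100 * (272/100)"
    using e_approx_32 by (intro mult_mono) (auto simp: abs_if split: if_splits)
  finally have e2: "exp 2 \<le> (75/10::real)" by simp
  have "exp x \<le> exp 2" "exp (-x) \<le> exp 0" using assms by (subst exp_le_cancel_iff; simp)+
  with e2 have "exp x + exp (-x) \<le> 10" unfolding exp_zero by linarith
  then show ?thesis by (simp add: cosh_def)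
qed

text \<open>Integrating \<open>cosh_minus_1_le\<close> gives 3 sinh x \<le> x (2 + cosh x); the
  crude bound cosh x \<le> 5 on [0, 2] then suffices.\<close>

lemma sinh_le_3_mult:
  fixes x :: real assumes "0 \<le> x" "x \<le> 2" shows "sinh x \<le> 3 * x"
proof -
  have "(\<lambda>x. x * (2 + cosh x) - 3 * sinh x) 0 \<le> (\<lambda>x. x * (2 + cosh x) - 3 * sinh x) x"
  proof (rule DERIV_nonneg_imp_nondecreasing[OF assms(1)])
    fix y :: real assume y: "0 \<le> y" "y \<le> x"
    show "\<exists>d. ((\<lambda>x. x * (2 + cosh x) - 3 * sinh x) has_real_derivative d) (at y) \<and> 0 \<le> d"
      using cosh_minus_1_le[OF y(1)]
      by (intro exI[of _ "2 - 2 * cosh y + y * sinh y"] conjI)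
        (auto intro!: derivative_eq_intros simp: field_simps)
  qed
  moreover have "x * (2 + cosh x) \<le> x * (2 + 5)"
    using assms cosh_le_5 by (intro mult_left_mono add_left_mono) auto
  ultimately show ?thesis using assms by simp
qed

text \<open>Up to the factor r^2, this expression bounds from below the slope in \<beta> = - b of
  the gap in \<open>hoeffding_two_state\<close>, once cosh \<phi> and sinh \<phi> there are replaced
  by 1 and \<phi>. It is nonnegative at \<beta> = |m| and increases in \<beta>.\<close>

lemma hoeffding_aux_slope:
  fixes r m \<beta> :: real
  assumes r: "0 < r" "r \<le> 1" and m: "\<bar>m\<bar> \<le> \<beta>" "\<beta> \<le> 1"
  shows "0 \<le> \<beta> + \<beta> * (\<beta>\<^sup>2 - m\<^sup>2) / 2 + m * cosh (r * (m + \<beta>)) - sinh (r * (m + \<beta>)) / r"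
proof -
  define W where "W = (\<lambda>\<beta>. \<beta> + \<beta> * (\<beta>\<^sup>2 - m\<^sup>2) / 2 + m * cosh (r * (m + \<beta>)) - sinh (r * (m + \<beta>)) / r)"
  have "W \<bar>m\<bar> \<le> W \<beta>"
  proof (rule DERIV_nonneg_imp_nondecreasing[OF m(1)])
    fix y assume y: "\<bar>m\<bar> \<le> y" "y \<le> \<beta>"
    define \<tau> where "\<tau> = r * (m + y)"
    have my: "0 \<le> m + y" "0 \<le> y - m" "m + y \<le> 2" using y m by auto
    have \<tau>: "0 \<le> \<tau>" "\<tau> \<le> 2"
      using r my mult_mono[of r 1 "m + y" 2] by (auto simp: \<tau>_def)
    have \<tau>sinh: "\<tau> / 2 * sinh \<tau> = (r * m * sinh \<tau> + r * y * sinh \<tau>) / 2"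
      by (simp add: \<tau>_def algebra_simps)
    \<comment> \<open>By \<open>cosh_minus_1_le\<close>, nonnegativity of the derivative reduces to
      r (y - m) sinh \<tau> \<le> 3 y^2 - m^2.\<close>
    have "r * (y - m) * sinh \<tau> \<le> r * (y - m) * (3 * \<tau>)"
      using r my sinh_le_3_mult[OF \<tau>] by (intro mult_left_mono) auto
    also have "\<dots> = 3 * r\<^sup>2 * (y\<^sup>2 - m\<^sup>2)"
      by (simp add: \<tau>_def power2_eq_square algebra_simps)
    also have "\<dots> \<le> 3 * 1 * (y\<^sup>2 - m\<^sup>2)"
      using r y by (intro mult_right_mono mult_left_mono)
        (auto simp: power_le_one abs_le_square_iff[symmetric])
    also have "\<dots> \<le> 3 * y\<^sup>2 - m\<^sup>2" by simp
    finally have "cosh \<tau> - 1 \<le> m * r * sinh \<tau> + (3 * y\<^sup>2 - m\<^sup>2) / 2"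
      using cosh_minus_1_le[OF \<tau>(1)] \<tau>sinh by (simp add: algebra_simps add_divide_distrib diff_divide_distrib)
    then show "\<exists>d. (W has_real_derivative d) (at y) \<and> 0 \<le> d"
      unfolding W_def using r
      by (intro exI[of _ "1 + (3 * y\<^sup>2 - m\<^sup>2) / 2 + m * r * sinh \<tau> - cosh \<tau>"] conjI)
        (auto intro!: derivative_eq_intros simp: \<tau>_def power2_eq_square field_simps)
  qed
  moreover have "0 \<le> W \<bar>m\<bar>"
  proof (cases "m \<ge> 0")
    case True
    define x where "x = r * m"
    have "sinh x * cosh x \<le> (x * cosh x) * cosh x"
      using r True by (intro mult_right_mono sinh_le_mult_cosh) (auto simp: x_def)
    then have "0 \<le> 2 * x * (cosh x)\<^sup>2 - 2 * (sinh x * cosh x)"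
      by (simp add: power2_eq_square)
    also have "\<dots> = x + x * cosh (2 * x) - sinh (2 * x)"
      unfolding cosh_double_cosh sinh_double by (simp add: algebra_simps)
    also have "\<dots> = r * W \<bar>m\<bar>"
      using r True by (simp add: W_def x_def algebra_simps mult_2)
    finally show ?thesis using r by (simp add: zero_le_mult_iff)
  qed (simp add: W_def)
  ultimately show ?thesis by (simp add: W_def)
qed

text \<open>For \<open>r = 1\<close> this is Hoeffding's lemma for a Bernoulli variable. The difference of the two sides
  is nonnegative for \<open>\<bar>b\<bar> = \<bar>m\<bar>\<close> and grows from there, in \<open>m\<close> if \<open>\<bar>b\<bar> \<le> m\<close> and in \<open>- b\<close> otherwise.\<close>

lemma hoeffding_two_state:
  fixes r m b :: real
  assumes r: "0 < r" "r \<le> 1" and mb: "-1 \<le> b" "b \<le> m" "m \<le> 1"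
  shows "cosh (r * (m - b)) - r * m * sinh (r * (m - b))
       \<le> cosh (r * (b\<^sup>2 - m\<^sup>2) / 2) + r * sinh (r * (b\<^sup>2 - m\<^sup>2) / 2)"
proof -
  define F where "F = (\<lambda>b m. cosh (r * (b\<^sup>2 - m\<^sup>2) / 2) + r * sinh (r * (b\<^sup>2 - m\<^sup>2) / 2)
      - cosh (r * (m - b)) + r * m * sinh (r * (m - b)))"
  have diag: "0 \<le> F (- m) m" if "m \<ge> 0" for m
  proof -
    define x where "x = r * m"
    have x: "x \<ge> 0" using r that by (simp add: x_def)
    have "F (- m) m = 1 - cosh (2 * x) + x * sinh (2 * x)"
      by (simp add: F_def x_def algebra_simps mult_2)
    also have "\<dots> = 2 * sinh x * (x * cosh x - sinh x)"
      unfolding cosh_double_cosh cosh_square_eq sinh_double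
      by (simp add: power2_eq_square algebra_simps)
    finally show ?thesis using x sinh_le_mult_cosh[OF x] by simp
  qed
  have diag': "F m m = 0" for m by (simp add: F_def)
  have "0 \<le> F b m"
  proof (cases "\<bar>b\<bar> \<le> m")
    case True
    have "F b \<bar>b\<bar> \<le> F b m"
    proof (rule DERIV_nonneg_imp_nondecreasing[OF True])
      fix y assume y: "\<bar>b\<bar> \<le> y" "y \<le> m"
      define \<phi> where "\<phi> = r * (b\<^sup>2 - y\<^sup>2) / 2"
      define \<tau> where "\<tau> = r * (y - b)"
      \<comment> \<open>\<open>- \<phi>\<close> is \<tau> times the mean of y and b, a factor in
        [0, 1]; so cosh \<phi> \<le> cosh \<tau> and sinh \<phi> \<le> 0, which decides the sign of
        the derivative.\<close>
      have "- \<phi> = \<tau> * ((y + b) / 2)" by (simp add: \<phi>_def \<tau>_def power2_eq_square field_simps)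
      moreover have "0 \<le> \<tau>" "0 \<le> (y + b) / 2" "(y + b) / 2 \<le> 1"
        using r y mb by (auto simp: \<tau>_def)
      ultimately have "0 \<le> - \<phi>" "- \<phi> \<le> \<tau>"
        by (metis mult_nonneg_nonneg, metis mult_left_le)
      then have "cosh \<phi> \<le> cosh \<tau>" "sinh \<phi> \<le> 0"
        using cosh_real_nonneg_le_iff[of "- \<phi>" \<tau>] \<open>0 \<le> \<tau>\<close> by auto
      moreover from this(1) have "0 \<le> r * (cosh \<tau> - cosh \<phi>)" using r by simp
      ultimately have "0 \<le> r * (cosh \<tau> - cosh \<phi>) - sinh \<phi>" by linarith
      then have "0 \<le> r * y * (r * (cosh \<tau> - cosh \<phi>) - sinh \<phi>)"
        using r y by (intro mult_nonneg_nonneg) auto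
      then show "\<exists>d. ((F b) has_real_derivative d) (at y) \<and> 0 \<le> d"
        unfolding F_def
        by (intro exI[of _ "r * y * (r * (cosh \<tau> - cosh \<phi>) - sinh \<phi>)"] conjI)
          (auto intro!: derivative_eq_intros simp: \<tau>_def \<phi>_def power2_eq_square field_simps)
    qed
    moreover have "0 \<le> F b \<bar>b\<bar>" using diag[of "\<bar>b\<bar>"] diag'[of b] by (cases "b \<ge> 0") auto
    ultimately show ?thesis by simp
  next
    case False
    define \<beta> where "\<beta> = - b"
    have \<beta>: "\<bar>m\<bar> \<le> \<beta>" "\<beta> \<le> 1" using False mb by (auto simp: \<beta>_def abs_if split: if_splits)
    have "(\<lambda>\<beta>. F (- \<beta>) m) \<bar>m\<bar> \<le> (\<lambda>\<beta>. F (- \<beta>) m) \<beta>"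
    proof (rule DERIV_nonneg_imp_nondecreasing[OF \<beta>(1)])
      fix y assume y: "\<bar>m\<bar> \<le> y" "y \<le> \<beta>"
      define \<phi> where "\<phi> = r * (y\<^sup>2 - m\<^sup>2) / 2"
      define \<tau> where "\<tau> = r * (m + y)"
      define w where "w = y * r * cosh \<phi> + y * sinh \<phi> + r * m * cosh \<tau> - sinh \<tau>"
      have \<phi>: "0 \<le> \<phi>" using y r by (auto simp: \<phi>_def abs_le_square_iff[symmetric])
      have "0 \<le> y" using y by simp
      have "0 \<le> r * (y + y * (y\<^sup>2 - m\<^sup>2) / 2 + m * cosh \<tau> - sinh \<tau> / r)"
        using hoeffding_aux_slope[OF r y(1)] y(2) \<beta>(2) r by (simp add: \<tau>_def)
      also have "\<dots> = y * r * 1 + y * \<phi> + r * m * cosh \<tau> - sinh \<tau>"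
        using r by (simp add: \<phi>_def algebra_simps)
      also have "\<dots> \<le> w"
        unfolding w_def using r \<open>0 \<le> y\<close> \<phi> cosh_real_ge_1[of \<phi>] real_le_sinh[OF \<phi>]
        by (intro diff_right_mono add_right_mono add_mono mult_left_mono) auto
      finally have "0 \<le> r * w" using r by simp
      then show "\<exists>d. ((\<lambda>\<beta>. F (- \<beta>) m) has_real_derivative d) (at y) \<and> 0 \<le> d"
        unfolding F_def
        by (intro exI[of _ "r * w"] conjI)
          (auto intro!: derivative_eq_intros simp: w_def \<tau>_def \<phi>_def power2_eq_square field_simps)
    qed
    moreover have "0 \<le> F (- \<bar>m\<bar>) m" using diag[of m] diag'[of m] by (cases "m \<ge> 0") auto
    ultimately show ?thesis by (simp add: \<beta>_def)
  qed
  then show ?thesis by (simp add: F_def)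
qed

section \<open>The tilted two-state chain\<close>

locale two_state_tilt =
  fixes \<mu> a l :: real
  assumes \<mu>: "0 < \<mu>" and \<mu>a: "\<mu> < a" and a: "a < 1" and l: "0 \<le> l" "l < 1"
begin

text \<open>\<open>p\<close> is the two-state chain with stationary law \<open>(1 - \<mu>, \<mu>)\<close> and second eigenvalue \<open>l\<close>.
  With weight \<open>Y / X\<close> on state 1 the tilted matrix has leading eigenvalue \<open>Y\<close>, and \<open>q\<close> is its
  Doob transform, with stationary law \<open>(1 - a, a)\<close>.\<close>

definition "s = sqrt (1 + 4 * l * a * (1 - a) / (\<mu> * (1 - \<mu>) * (1 - l)\<^sup>2))"
definition "p00 = 1 - \<mu> + \<mu> * l"
definition "p01 = \<mu> * (1 - l)"
definition "p10 = (1 - \<mu>) * (1 - l)"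
definition "p11 = \<mu> + (1 - \<mu>) * l"
definition "q01 = 2 * a / (1 + s)"
definition "q10 = 2 * (1 - a) / (1 + s)"
definition "X = p11 / (1 - q10)"
definition "Y = p00 / (1 - q01)"

lemma p_pos: "0 < p00" "0 < p01" "0 < p10" "0 < p11"
  unfolding p00_def p01_def p10_def p11_def using \<mu> \<mu>a a l by (auto intro!: add_pos_nonneg)

lemma p_det: "p00 * p11 - p01 * p10 = l"
  unfolding p00_def p01_def p10_def p11_def by (simp add: algebra_simps)

lemma p_row: "p00 = 1 - p01" "p11 = 1 - p10"
  unfolding p00_def p01_def p10_def p11_def by (simp_all add: algebra_simps)

lemma s_ge_1: "1 \<le> s"
  unfolding s_def using \<mu> \<mu>a a l by simp

lemma q_bounds: "0 < q01" "q01 < 1" "0 < q10" "q10 < 1"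
  using s_ge_1 \<mu> \<mu>a a by (auto simp: q01_def q10_def divide_simps)

lemma q_balance: "(1 - a) * q01 = a * q10"
  by (simp add: q01_def q10_def)

text \<open>Weighting a column and taking the Doob transform both preserve the ratio of off-diagonal
  to diagonal products. With q01 = u a and q10 = u (1 - a) this becomes a quadratic equation for u
  with positive root 2 / (1 + s), which explains the formula for \<open>s\<close>.\<close>

lemma edge_balance: "p01 * p10 * ((1 - q01) * (1 - q10)) = p00 * p11 * (q01 * q10)"
proof -
  define c where "c = p01 * p10"
  have c: "c = \<mu> * (1 - \<mu>) * (1 - l)\<^sup>2"
    by (simp add: c_def p01_def p10_def power2_eq_square mult_ac)
  have "c > 0" using p_pos by (simp add: c_def)
  have "s\<^sup>2 = 1 + 4 * l * a * (1 - a) / c"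
    unfolding s_def c[symmetric] using \<mu> \<mu>a a l \<open>c > 0\<close> by simp
  then have cs: "c * (s\<^sup>2 - 1) = 4 * l * a * (1 - a)" using \<open>c > 0\<close> by simp
  define u where "u = 2 / (1 + s)"
  have "1 + s \<noteq> 0" using s_ge_1 by linarith
  then have u: "u * (1 + s) = 2" by (metis u_def nonzero_divide_eq_eq)
  have q: "q01 = u * a" "q10 = u * (1 - a)" by (simp_all add: q01_def q10_def u_def)
  have "c * (1 - u) * (1 + s)\<^sup>2 = c * (1 + s) * ((1 + s) - u * (1 + s))" by algebra
  also have "\<dots> = c * (s\<^sup>2 - 1)" unfolding u by algebra
  also have "\<dots> = l * a * (1 - a) * (u * (1 + s))\<^sup>2" unfolding u cs by simp
  also have "\<dots> = l * u\<^sup>2 * a * (1 - a) * (1 + s)\<^sup>2" by algebra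
  finally have "c * (1 - u) = l * u\<^sup>2 * a * (1 - a)" using s_ge_1 by simp
  then have "c * ((1 - q01) * (1 - q10)) = (c + l) * (q01 * q10)" unfolding q by algebra
  also have "c + l = p00 * p11" using p_det by (simp add: c_def)
  finally show ?thesis by (simp add: c_def)
qed

text \<open>By \<open>edge_balance\<close> the odds of q01 and q10 have the same product as those of
  p01 and p10, so the two rates move in opposite directions. The direction is fixed by a > \<mu>:
  under the law (1 - a, a), the flow of p out of state 1 exceeds the flow into it.\<close>

lemma q_vs_p: "p01 \<le> q01" "q10 \<le> p10"
proof -
  have less: "p10 < q10" if "q01 < p01"
  proof (rule ccontr)
    assume "\<not> p10 < q10"
    then have "q10 * p11 \<le> p10 * (1 - q10)" by (simp add: p_row algebra_simps)
    moreover have "q01 * p00 < p01 * (1 - q01)" using that by (simp add: p_row algebra_simps)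
    ultimately have "(q01 * p00) * (q10 * p11) < (p01 * (1 - q01)) * (p10 * (1 - q10))"
      using p_pos q_bounds by (rule_tac mult_less_le_imp_less) auto
    then show False using edge_balance by (simp add: mult_ac)
  qed
  have "a * p10 > (1 - a) * p01"
  proof -
    have "a * p10 - (1 - a) * p01 = (1 - l) * (a - \<mu>)" unfolding p10_def p01_def by algebra
    also have "\<dots> > 0" using \<mu>a l by simp
    finally show ?thesis by simp
  qed
  moreover have "(1 - a) * q01 < (1 - a) * p01" "a * p10 < a * q10" if "q01 < p01"
    using less[OF that] that \<mu> \<mu>a a by auto
  ultimately show q01: "p01 \<le> q01" using q_balance by force
  show "q10 \<le> p10"
  proof (rule ccontr)
    assume "\<not> q10 \<le> p10"
    then have "p10 * (1 - q10) < q10 * p11" by (simp add: p_row algebra_simps)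
    moreover have "p01 * (1 - q01) \<le> q01 * p00" using q01 by (simp add: p_row algebra_simps)
    ultimately have "(p10 * (1 - q10)) * (p01 * (1 - q01)) < (q10 * p11) * (q01 * p00)"
      using p_pos q_bounds by (rule_tac mult_less_le_imp_less) auto
    then show False using edge_balance by (simp add: mult_ac)
  qed
qed

text \<open>X \<le> 1 \<le> Y makes the tilt ln (Y / X) nonnegative, and l < X keeps X - l and Y - l
  positive.\<close>

lemma X_Y_bounds: "l < X" "X \<le> 1" "1 \<le> Y"
proof -
  show "X \<le> 1" "1 \<le> Y"
    using q_vs_p q_bounds by (auto simp: X_def Y_def p_row divide_simps)
  have "p11 - l = (1 - l) * \<mu>" unfolding p11_def by algebra
  moreover have "0 < (1 - l) * \<mu>" using l \<mu> by simp
  ultimately have "l < p11" by linarith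
  also have "p11 \<le> X"
    using q_bounds p_pos by (auto simp: X_def divide_simps)
  finally show "l < X" .
qed

lemma X_Y_pos: "0 < X" "0 < Y"
  using X_Y_bounds l by linarith+

text \<open>Equivalent to X Y - p00 X - p11 Y + l = 0, which says that Y is an eigenvalue of p with
  column 1 multiplied by Y / X. Clearing the denominators of X and Y reduces it to
  \<open>edge_balance\<close>.\<close>

lemma characteristic_equation: "(1 - l) * ((1 - \<mu>) * (X - l) + \<mu> * (Y - l)) = (X - l) * (Y - l)"
proof -
  have nz: "1 - q01 \<noteq> 0" "1 - q10 \<noteq> 0" using q_bounds by auto
  have X: "X * (1 - q10) = p11" and Y: "Y * (1 - q01) = p00"
    using nz by (simp_all add: X_def Y_def)
  have "(X * Y - p00 * X - p11 * Y + l) * ((1 - q01) * (1 - q10))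
      = (X * (1 - q10)) * (Y * (1 - q01)) - p00 * (X * (1 - q10)) * (1 - q01)
        - p11 * (Y * (1 - q01)) * (1 - q10) + l * ((1 - q01) * (1 - q10))"
    by algebra
  also have "\<dots> = p00 * p11 * (q01 * q10) - (p00 * p11 - l) * ((1 - q01) * (1 - q10))"
    unfolding X Y by algebra
  also have "p00 * p11 - l = p01 * p10" using p_det by simp
  also have "p00 * p11 * (q01 * q10) - p01 * p10 * ((1 - q01) * (1 - q10)) = 0"
    by (simp only: edge_balance diff_self)
  finally have "X * Y - p00 * X - p11 * Y + l = 0" using nz by simp
  then show ?thesis unfolding p00_def p11_def by algebra
qed

text \<open>Supplies the tilt and the growth rate \<rho> = Y for \<open>path_event_prob_le\<close>:
  the third claim is its scalar condition with equality, the fourth turns the bound at threshold n a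
  into the product of powers.\<close>

lemma tilt_condition:
  defines "\<theta> \<equiv> ln (Y / X)"
  shows "0 \<le> \<theta>" "l * exp \<theta> < Y"
    "(1 - l) * ((1 - \<mu>) * (1 / (Y - l)) + \<mu> * (exp \<theta> / (Y - l * exp \<theta>))) = 1"
    "exp (- \<theta> * (real n * a)) * Y ^ n = X powr (real n * a) * Y powr (real n * (1 - a))"
proof -
  note bd = X_Y_bounds X_Y_pos
  have e: "exp \<theta> = Y / X" using bd by (simp add: \<theta>_def)
  show "0 \<le> \<theta>" using bd by (simp add: \<theta>_def)
  have "l * Y < X * Y" using bd by (intro mult_strict_right_mono) auto
  then show "l * exp \<theta> < Y" using bd(4) by (simp add: e pos_divide_less_eq mult.commute)
  define A B where "A = X - l" and "B = Y - l"
  have AB: "A > 0" "B > 0" using bd by (auto simp: A_def B_def)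
  \<comment> \<open>Hence the third claim is \<open>characteristic_equation\<close> divided by (X -
    l) (Y - l).\<close>
  have "Y - l * exp \<theta> = Y / X * A" using bd(4) by (simp add: e A_def right_diff_distrib)
  then have "exp \<theta> / (Y - l * exp \<theta>) = 1 / A"
    using bd(4,5) by (simp add: e)
  moreover have "(1 - \<mu>) * (1 / B) + \<mu> * (1 / A) = ((1 - \<mu>) * A + \<mu> * B) / (A * B)"
    using AB by (simp add: field_simps)
  moreover have "(1 - l) * ((1 - \<mu>) * A + \<mu> * B) = A * B"
    unfolding A_def B_def by (rule characteristic_equation)
  ultimately show "(1 - l) * ((1 - \<mu>) * (1 / (Y - l)) + \<mu> * (exp \<theta> / (Y - l * exp \<theta>))) = 1"
    unfolding B_def[symmetric] using AB by simp
  have "Y ^ n = exp (real n * ln Y)" using bd by (simp add: exp_of_nat_mult)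
  then show "exp (- \<theta> * (real n * a)) * Y ^ n = X powr (real n * a) * Y powr (real n * (1 - a))"
    using bd by (simp add: powr_def \<theta>_def ln_div algebra_simps flip: exp_add)
qed

text \<open>The relative entropy rate of \<open>q\<close> with respect to \<open>p\<close> is \<open>- (a * ln X + (1 - a) * ln Y)\<close>; this is
  its Donsker--Varadhan lower bound with the positive test vector \<open>(1, h)\<close>.\<close>

lemma entropy_dual:
  assumes pos: "0 < \<rho>" "0 < h"
    and row0: "p00 + p01 * exp \<theta> * h \<le> \<rho>"
    and row1: "p10 + p11 * exp \<theta> * h \<le> \<rho> * h"
  shows "a * ln X + (1 - a) * ln Y \<le> ln \<rho> - a * \<theta>"
proof -
  have gibbs: "q * (ln z - ln q) \<le> z - q" if "0 < q" "0 < z" for q z :: real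
    using mult_left_mono[OF ln_le_minus_one[of "z / q"], of q] that
    by (simp add: ln_div right_diff_distrib)
  note pp = p_pos and qq = q_bounds
  \<comment> \<open>Gibbs' inequality for row 0 of q against the row p00 / \<rho>, p01 exp \<theta>
    h / \<rho>, whose mass is at most 1 by \<open>row0\<close>; row 1 is treated likewise.\<close>
  have "(1 - q01) * (ln (p00 / \<rho>) - ln (1 - q01)) + q01 * (ln (p01 * exp \<theta> * h / \<rho>) - ln q01)
      \<le> (p00 / \<rho> - (1 - q01)) + (p01 * exp \<theta> * h / \<rho> - q01)"
    using pp qq pos by (intro add_mono gibbs) auto
  also have "\<dots> = (p00 + p01 * exp \<theta> * h) / \<rho> - 1" by (simp add: add_divide_distrib)
  also have "\<dots> \<le> 0" using row0 pos by (simp add: divide_simps)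
  finally have r0: "(1 - q01) * (ln (p00 / \<rho>) - ln (1 - q01)) + q01 * (ln (p01 * exp \<theta> * h / \<rho>) - ln q01) \<le> 0" .
  have "q10 * (ln (p10 / (\<rho> * h)) - ln q10) + (1 - q10) * (ln (p11 * exp \<theta> * h / (\<rho> * h)) - ln (1 - q10))
      \<le> (p10 / (\<rho> * h) - q10) + (p11 * exp \<theta> * h / (\<rho> * h) - (1 - q10))"
    using pp qq pos by (intro add_mono gibbs) auto
  also have "\<dots> = (p10 + p11 * exp \<theta> * h) / (\<rho> * h) - 1" by (simp add: add_divide_distrib)
  also have "\<dots> \<le> 0" using row1 pos by (simp add: divide_simps)
  finally have r1: "q10 * (ln (p10 / (\<rho> * h)) - ln q10)
      + (1 - q10) * (ln (p11 * exp \<theta> * h / (\<rho> * h)) - ln (1 - q10)) \<le> 0" .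
  define x y where "x = ln X" and "y = ln Y"
  have x: "x = ln p11 - ln (1 - q10)" and y: "y = ln p00 - ln (1 - q01)"
    using pp qq by (simp_all add: x_def y_def X_def Y_def ln_div)
  have "ln (p01 * p10 * ((1 - q01) * (1 - q10))) = ln (p00 * p11 * (q01 * q10))"
    by (simp only: edge_balance)
  then have e: "ln p01 - ln q01 + (ln p10 - ln q10) = x + y"
    using pp qq by (simp add: ln_mult x y)
  define z where "z = ln p01 - ln q01 + ln h"
  have r0': "(1 - q01) * (y - ln \<rho>) + q01 * (z + \<theta> - ln \<rho>) \<le> 0"
    using r0 pp qq pos by (simp add: ln_mult ln_div y z_def algebra_simps)
  have z': "ln p10 - ln q10 - ln h = x + y - z" using e by (simp add: z_def)
  have r1': "q10 * (x + y - z - ln \<rho>) + (1 - q10) * (x + \<theta> - ln \<rho>) \<le> 0"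
    unfolding z'[symmetric] using r1 pp qq pos by (simp add: ln_mult ln_div x algebra_simps)
  \<comment> \<open>The rows are averaged with the stationary law (1 - a, a) of q; by
    \<open>q_balance\<close> the terms in z, and with them the test vector, cancel.\<close>
  have "0 \<ge> (1 - a) * ((1 - q01) * (y - ln \<rho>) + q01 * (z + \<theta> - ln \<rho>))
     + a * (q10 * (x + y - z - ln \<rho>) + (1 - q10) * (x + \<theta> - ln \<rho>))"
    using mult_nonneg_nonpos[OF _ r0', of "1 - a"] mult_nonneg_nonpos[OF _ r1', of a] \<mu> \<mu>a a by linarith
  also have "(1 - a) * ((1 - q01) * (y - ln \<rho>) + q01 * (z + \<theta> - ln \<rho>))
     + a * (q10 * (x + y - z - ln \<rho>) + (1 - q10) * (x + \<theta> - ln \<rho>))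
     = a * x + (1 - a) * y + a * \<theta> - ln \<rho> + ((1 - a) * q01 - a * q10) * (z + \<theta> - y)"
    by algebra
  also have "\<dots> = a * x + (1 - a) * y + a * \<theta> - ln \<rho>" by (simp add: q_balance)
  finally show ?thesis by (simp add: x_def y_def)
qed

text \<open>The test parameters come from Gaussian exponential moments: with \<open>r = (1 - l) / (1 + l)\<close> the
  eigenvalue of the tilted matrix is at most \<open>exp (\<theta> * \<mu> + \<theta>\<^sup>2 / (8 * r))\<close> at the
  Gaussian-optimal tilt \<open>\<theta> = 4 * r * (a - \<mu>)\<close>.\<close>

lemma entropy_le:
  "a * ln X + (1 - a) * ln Y \<le> - 2 * ((1 - l) / (1 + l)) * (a - \<mu>)\<^sup>2"
proof -
  define r where "r = (1 - l) / (1 + l)"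
  define m b where "m = 1 - 2 * \<mu>" and "b = 1 - 2 * a"
  define \<tau> \<phi> where "\<tau> = r * (m - b)" and "\<phi> = r * (b\<^sup>2 - m\<^sup>2) / 2"
  define \<rho> t where "\<rho> = exp (\<tau> + \<phi>)" and "t = exp (2 * \<tau>)"
  have r: "0 < r" "r \<le> 1" using l by (auto simp: r_def)
  have lr: "(1 + l) * r = 1 - l" using l by (simp add: r_def)
  have p: "p00 = (1 + l) * (1 + r * m) / 2" "p11 = (1 + l) * (1 - r * m) / 2"
  proof -
    have "(1 + l) * (1 + r * m) = (1 + l) + (1 + l) * r * m" "(1 + l) * (1 - r * m) = (1 + l) - (1 + l) * r * m"
      by algebra+
    then show "p00 = (1 + l) * (1 + r * m) / 2" "p11 = (1 + l) * (1 - r * m) / 2"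
      unfolding lr by (simp_all add: p00_def p11_def m_def field_simps)
  qed
  have t: "t > 0" and \<rho>: "\<rho> > 0" by (simp_all add: t_def \<rho>_def)
  \<comment> \<open>This is \<open>hoeffding_two_state\<close> times 1 + l. A further factor exp (2
    \<tau> + \<phi>) turns it into \<open>quad\<close>: the characteristic polynomial of the tilted
    matrix is nonnegative at \<rho>.\<close>
  have key: "p00 * exp (- \<tau>) + p11 * exp \<tau> \<le> exp \<phi> + l * exp (- \<phi>)"
  proof -
    have "p00 * exp (- \<tau>) + p11 * exp \<tau> = (1 + l) * (cosh \<tau> - r * m * sinh \<tau>)"
      unfolding p by (simp add: cosh_def sinh_def field_simps)
    also have "\<dots> \<le> (1 + l) * (cosh \<phi> + r * sinh \<phi>)"
      unfolding \<tau>_def \<phi>_def using r \<mu> \<mu>a a l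
      by (intro mult_left_mono hoeffding_two_state) (auto simp: m_def b_def)
    also have "\<dots> = (1 + l) * cosh \<phi> + ((1 + l) * r) * sinh \<phi>" by algebra
    also have "\<dots> = exp \<phi> + l * exp (- \<phi>)"
      unfolding lr by (simp add: cosh_def sinh_def field_simps)
    finally show ?thesis .
  qed
  have quad: "\<rho> * (p00 + p11 * t) \<le> \<rho>\<^sup>2 + l * t"
  proof -
    have "\<rho> * (p00 + p11 * t) = exp (2 * \<tau> + \<phi>) * (p00 * exp (- \<tau>) + p11 * exp \<tau>)"
      by (simp add: \<rho>_def t_def algebra_simps flip: exp_add)
    also have "\<dots> \<le> exp (2 * \<tau> + \<phi>) * (exp \<phi> + l * exp (- \<phi>))"
      by (intro mult_left_mono key) simp
    also have "\<dots> = \<rho>\<^sup>2 + l * t"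
      by (simp add: \<rho>_def t_def power2_eq_square algebra_simps flip: exp_add)
    finally show ?thesis .
  qed
  \<comment> \<open>l t is the determinant of the tilted matrix. By \<open>quad\<close> alone,
    \<rho> could lie below both eigenvalues, but then \<rho>^2 would be at most l t.\<close>
  have big: "l * t < \<rho>\<^sup>2"
  proof -
    have "\<bar>m\<bar> < 1" using \<mu> \<mu>a a by (simp add: m_def)
    then have "m\<^sup>2 < 1" by (simp add: abs_square_less_1)
    then have "r * (m\<^sup>2 - b\<^sup>2) < r * 1" using r by (intro mult_strict_left_mono) (auto intro: le_less_trans[of _ "m\<^sup>2"])
    moreover have "2 * \<phi> = - (r * (m\<^sup>2 - b\<^sup>2))" by (simp add: \<phi>_def field_simps)
    ultimately have "1 - r < 1 + 2 * \<phi>" by linarith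
    also have "\<dots> \<le> exp (2 * \<phi>)" by (rule exp_ge_add_one_self)
    finally have "1 - r < exp (2 * \<phi>)" .
    moreover have "l \<le> 1 - r"
    proof -
      have "(1 - r) - l = l * (1 - l) / (1 + l)" using l by (simp add: r_def field_simps)
      then show ?thesis using l by (smt (verit) divide_nonneg_pos mult_nonneg_nonneg)
    qed
    ultimately have "l * t < exp (2 * \<phi>) * t" using t by (intro mult_strict_right_mono) auto
    then show ?thesis by (simp add: \<rho>_def t_def power2_eq_square algebra_simps flip: exp_add)
  qed
  have prod: "p01 * p10 * t \<le> (\<rho> - p00) * (\<rho> - p11 * t)"
  proof -
    have "(\<rho> - p00) * (\<rho> - p11 * t) - p01 * p10 * t
        = \<rho>\<^sup>2 - \<rho> * (p00 + p11 * t) + (p00 * p11 - p01 * p10) * t" by algebra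
    then show ?thesis using quad unfolding p_det by simp
  qed
  have gt: "p00 < \<rho>"
  proof (rule ccontr)
    assume "\<not> p00 < \<rho>"
    moreover have "0 < (\<rho> - p00) * (\<rho> - p11 * t)"
      using prod p_pos t by (smt (verit) mult_pos_pos)
    ultimately have "\<rho> < p00" "\<rho> < p11 * t" by (auto simp: zero_less_mult_iff)
    then have "\<rho> * (2 * \<rho>) < \<rho> * (p00 + p11 * t)" using \<rho> by (intro mult_strict_left_mono) auto
    with quad big show False by (simp add: power2_eq_square)
  qed
  \<comment> \<open>Chosen to give equality in row 0; row 1 is then \<open>prod\<close>.\<close>
  define h where "h = (\<rho> - p00) / (p01 * t)"
  have h: "h > 0" using gt p_pos t by (simp add: h_def)
  have row0: "p00 + p01 * t * h = \<rho>" using p_pos t by (simp add: h_def)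
  have "p10 \<le> (\<rho> - p11 * t) * h"
    using prod p_pos t by (simp add: h_def pos_le_divide_eq mult_ac)
  then have row1: "p10 + p11 * t * h \<le> \<rho> * h" by (simp add: algebra_simps)
  have "a * ln X + (1 - a) * ln Y \<le> ln \<rho> - a * (2 * \<tau>)"
    using row0 row1 by (intro entropy_dual[OF \<rho> h]) (simp_all add: t_def)
  also have "\<dots> = \<phi> + b * \<tau>" by (simp add: \<rho>_def b_def algebra_simps)
  also have "\<dots> = - 2 * r * (a - \<mu>)\<^sup>2"
    unfolding \<phi>_def \<tau>_def b_def m_def by (simp add: power2_eq_square field_simps)
  finally show ?thesis by (simp add: r_def)
qed

lemma powr_bound_le_exp:
  "X powr (real n * a) * Y powr (real n * (1 - a))
     \<le> exp (- 2 * ((1 - l) / (1 + l)) * real n * (a - \<mu>)\<^sup>2)"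
proof -
  have "X powr (real n * a) * Y powr (real n * (1 - a)) = exp (real n * (a * ln X + (1 - a) * ln Y))"
    using X_Y_pos by (simp add: powr_def algebra_simps flip: exp_add)
  also have "\<dots> \<le> exp (real n * (- 2 * ((1 - l) / (1 + l)) * (a - \<mu>)\<^sup>2))"
    by (subst exp_le_cancel_iff) (intro mult_left_mono entropy_le, simp)
  also have "real n * (- 2 * ((1 - l) / (1 + l)) * (a - \<mu>)\<^sup>2) = - 2 * ((1 - l) / (1 + l)) * real n * (a - \<mu>)\<^sup>2"
    by simp
  finally show ?thesis .
qed

end

section \<open>Spectral gap of a reversible chain\<close>

lemma finite_ex_max:
  fixes y :: "'s::finite \<Rightarrow> real"
  shows "\<exists>i. \<forall>j. y j \<le> y i"
proof -
  have "Max (range y) \<in> range y" by (intro Max_in) auto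
  then obtain i where "Max (range y) = y i" by (rule imageE)
  then show ?thesis by (metis Max_ge finite_class.finite_UNIV finite_imageI rangeI)
qed

section \<open>Stationary laws and harmonic functions\<close>

lemma mpow_stochastic:
  assumes "stochastic P"
  shows "stochastic (mpow P n)"
proof (induction n)
  case 0
  then show ?case by (simp add: stochastic_def mat_def if_distrib)
next
  case (Suc n)
  have "(\<Sum>j\<in>UNIV. \<Sum>k\<in>UNIV. mpow P n $ i $ k * P $ k $ j) = 1" for i
    using assms Suc by (subst sum.swap) (simp add: stochastic_def flip: sum_distrib_left)
  then show ?case
    using assms Suc by (simp add: stochastic_def matrix_matrix_mult_def sum_nonneg)
qed

lemma stationary_mpow:
  assumes "stationary P \<pi>"
  shows "(\<Sum>i\<in>UNIV. \<pi> i * mpow P n $ i $ j) = \<pi> j"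
proof (induction n arbitrary: j)
  case 0
  show ?case by (simp add: mat_def if_distrib[of "\<lambda>x. _ * x"] cong: if_cong)
next
  case (Suc n)
  have "(\<Sum>i\<in>UNIV. \<pi> i * mpow P (Suc n) $ i $ j)
      = (\<Sum>k\<in>UNIV. (\<Sum>i\<in>UNIV. \<pi> i * mpow P n $ i $ k) * P $ k $ j)"
    by (simp add: matrix_matrix_mult_def sum_distrib_left sum_distrib_right mult.assoc)
      (rule sum.swap)
  then show ?case using assms Suc by (simp add: stationary_def)
qed

text \<open>Some state carries mass, and irreducibility transports it to j by a power of P, under
  which \<pi> is invariant.\<close>

lemma stationary_pos:
  assumes "stochastic P" "irreducible_chain P" "stationary P \<pi>"
  shows "\<pi> j > 0"
proof -
  have nn: "\<And>i. \<pi> i \<ge> 0" and sum1: "(\<Sum>i\<in>UNIV. \<pi> i) = 1"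
    using assms(3) by (auto simp: stationary_def prob_vector_def)
  obtain i where "\<pi> i \<noteq> 0"
    using sum1 by (metis sum.neutral zero_neq_one)
  with nn have i: "\<pi> i > 0" by (simp add: order_less_le)
  obtain n where n: "mpow P n $ i $ j > 0"
    using assms(2) by (auto simp: irreducible_chain_def)
  have "mpow P n $ i $ j \<ge> 0" for i j
    using mpow_stochastic[OF assms(1)] by (auto simp: stochastic_def)
  then have "0 < (\<Sum>i\<in>UNIV. \<pi> i * mpow P n $ i $ j)"
    using i n nn by (intro sum_pos2[of _ i]) auto
  then show ?thesis by (simp add: stationary_mpow[OF assms(3)])
qed

lemma harmonic_mpow:
  assumes "\<And>i. (\<Sum>j\<in>UNIV. P $ i $ j * y j) = y i"
  shows "(\<Sum>j\<in>UNIV. mpow P n $ i $ j * y j) = y i"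
proof (induction n arbitrary: i)
  case 0
  show ?case by (simp add: mat_def if_distrib[of "\<lambda>x. x * _"] cong: if_cong)
next
  case (Suc n)
  have "(\<Sum>j\<in>UNIV. mpow P (Suc n) $ i $ j * y j)
      = (\<Sum>k\<in>UNIV. mpow P n $ i $ k * (\<Sum>j\<in>UNIV. P $ k $ j * y j))"
    by (simp add: matrix_matrix_mult_def sum_distrib_left sum_distrib_right mult.assoc)
      (rule sum.swap)
  then show ?case using assms Suc by simp
qed

text \<open>Maximum principle: at a maximum of y, the average of the nonnegative gaps under every
  power of P vanishes, and some power reaches any given state.\<close>

lemma harmonic_const:
  fixes y :: "'s::finite \<Rightarrow> real"
  assumes "stochastic P" "irreducible_chain P"
    and harm: "\<And>i. (\<Sum>j\<in>UNIV. P $ i $ j * y j) = y i"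
  shows "y i = y j"
proof -
  obtain i0 where i0: "\<And>j. y j \<le> y i0"
    using finite_ex_max[of y] by blast
  have "y j = y i0" for j
  proof -
    obtain n where n: "mpow P n $ i0 $ j > 0"
      using assms(2) by (auto simp: irreducible_chain_def)
    have st: "stochastic (mpow P n)" by (rule mpow_stochastic[OF assms(1)])
    have "(\<Sum>j\<in>UNIV. mpow P n $ i0 $ j * (y i0 - y j)) = 0"
      using st by (simp add: harmonic_mpow[OF harm] stochastic_def right_diff_distrib
          sum_subtractf flip: sum_distrib_right)
    then have "mpow P n $ i0 $ j * (y i0 - y j) = 0"
      using st i0 by (subst (asm) sum_nonneg_eq_0_iff) (auto simp: stochastic_def)
    with n show ?thesis by simp
  qed
  from this[of i] this[of j] show ?thesis by simp
qed

section \<open>Eigenvalues as roots of the characteristic polynomial\<close>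

lemma poly_det:
  fixes A :: "real poly^'n::finite^'n"
  shows "poly (det A) x = det (\<chi> i j. poly (A $ i $ j) x)"
  by (simp add: det_def poly_sum poly_prod)

lemma poly_char_poly_mat:
  "poly (char_poly_mat P) x = det (\<chi> i j. (if i = j then x else 0) - P $ i $ j)"
  unfolding char_poly_mat_def poly_det
  by (rule arg_cong[of _ _ det]) (simp add: vec_eq_iff)

lemma det_eq_0_iff_kernel:
  fixes A :: "real^'n::finite^'n"
  shows "det A = 0 \<longleftrightarrow> (\<exists>x. x \<noteq> 0 \<and> A *v x = 0)"
  using invertible_det_nz[of A] matrix_left_invertible_ker[of A] invertible_left_inverse[of A]
  by auto

lemma poly_char_poly_mat_eq_0_iff:
  fixes P :: "real^'s::finite^'s"
  shows "poly (char_poly_mat P) x = 0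
     \<longleftrightarrow> (\<exists>v. v \<noteq> 0 \<and> (\<forall>i. (\<Sum>j\<in>UNIV. P $ i $ j * v $ j) = x * v $ i))"
proof -
  have "((\<chi> i j. (if i = j then x else 0) - P $ i $ j) *v v) $ i
      = x * v $ i - (\<Sum>j\<in>UNIV. P $ i $ j * v $ j)" for v i
    by (simp add: matrix_vector_mult_def left_diff_distrib sum_subtractf
        if_distrib[of "\<lambda>x. x * _"])
  then show ?thesis
    by (simp add: poly_char_poly_mat det_eq_0_iff_kernel vec_eq_iff) (metis)
qed

text \<open>Take absolute values in the eigenvalue equation at a coordinate where |v| is
  maximal.\<close>

lemma char_poly_mat_root_le_1:
  fixes P :: "real^'s::finite^'s"
  assumes "stochastic P" "poly (char_poly_mat P) x = 0"
  shows "x \<le> 1"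
proof -
  obtain v where v: "v \<noteq> 0" "\<And>i. (\<Sum>j\<in>UNIV. P $ i $ j * v $ j) = x * v $ i"
    using assms(2) by (auto simp: poly_char_poly_mat_eq_0_iff)
  obtain i where i: "\<And>j. \<bar>v $ j\<bar> \<le> \<bar>v $ i\<bar>"
    using finite_ex_max[of "\<lambda>i. \<bar>v $ i\<bar>"] by blast
  have "v $ i \<noteq> 0" using v(1) i by (auto simp: vec_eq_iff)
  have "x * \<bar>v $ i\<bar> \<le> \<bar>\<Sum>j\<in>UNIV. P $ i $ j * v $ j\<bar>"
    by (simp add: v(2) abs_mult mult_right_mono)
  also have "\<dots> \<le> (\<Sum>j\<in>UNIV. P $ i $ j * \<bar>v $ i\<bar>)"
    using assms(1) i by (intro order_trans[OF sum_abs] sum_mono)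
      (auto simp: stochastic_def abs_mult intro!: mult_left_mono)
  also have "\<dots> = \<bar>v $ i\<bar>"
    using assms(1) by (simp add: stochastic_def flip: sum_distrib_right)
  finally show ?thesis using \<open>v $ i \<noteq> 0\<close> by simp
qed

lemma char_poly_mat_nonzero:
  assumes "stochastic P"
  shows "char_poly_mat P \<noteq> 0"
  using char_poly_mat_root_le_1[OF assms, of 2] by auto

text \<open>Adding all other columns of \<open>x I - P\<close> to column \<open>k\<close> makes that column constant \<open>x - 1\<close>.\<close>

lemma det_shift_stochastic:
  fixes P :: "real^'s::finite^'s"
  assumes "stochastic P"
  shows "det (\<chi> i j. (if i = j then x else 0) - P $ i $ j)
      = (x - 1) * det (\<chi> i j. if j = k then 1 else (if i = j then x else 0) - P $ i $ j)"
proof -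
  define A where "A = transpose (\<chi> i j. (if i = j then x else 0) - P $ i $ j)"
  let ?s = "\<Sum>j\<in>UNIV - {k}. row j A"
  have s: "?s \<in> vec.span {row j A |j. j \<noteq> k}"
    by (intro vec.span_sum vec.span_base) auto
  have "row k A + ?s = (\<Sum>j\<in>UNIV. row j A)"
    by (simp add: sum.remove[of UNIV k])
  also have "\<dots> = (x - 1) *s 1"
    using assms by (simp add: vec_eq_iff A_def row_def transpose_def sum_subtractf stochastic_def)
  finally have ks: "row k A + ?s = (x - 1) *s 1" .
  have "det A = det (\<chi> j. if j = k then row k A + ?s else row j A)"
    by (rule det_row_span[OF s, symmetric])
  also have "\<dots> = (x - 1) * det (\<chi> j. if j = k then 1 else row j A)"
    unfolding ks by (rule det_row_mul)
  also have "(\<chi> j. if j = k then 1 else row j A)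
      = transpose (\<chi> i j. if j = k then 1 else (if i = j then x else 0) - P $ i $ j)"
    by (simp add: vec_eq_iff A_def row_def transpose_def)
  finally show ?thesis by (simp add: A_def det_transpose)
qed

text \<open>Since \<open>second_eigenvalue\<close> counts algebraic multiplicities, 1 must be a
  simple root, not merely have a one-dimensional eigenspace. \<open>det_shift_stochastic\<close>
  splits off x - 1; a kernel vector of the remaining matrix at x = 1 comes from a harmonic function
  vanishing at k and is therefore zero.\<close>

lemma order_1_char_poly_mat:
  fixes P :: "real^'s::finite^'s"
  assumes "stochastic P" "irreducible_chain P" "stationary P \<pi>"
  shows "order 1 (char_poly_mat P) = 1"
proof -
  obtain k :: 's where True by simp
  define M where "M = (\<lambda>x. (\<chi> i j. if j = k then 1 else (if i = j then x else 0) - P $ i $ j) :: real^'s^'s)"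
  define q where "q = det ((\<chi> i j. if j = k then 1 else (if i = j then [:0, 1:] else 0) - [:P $ i $ j:]) :: real poly^'s^'s)"
  have q: "poly q x = det (M x)" for x
    unfolding q_def poly_det M_def
    by (rule arg_cong[of _ _ det]) (simp add: vec_eq_iff)
  have cp: "char_poly_mat P = [:-1, 1:] * q"
    by (intro poly_eq_poly_eq_iff[THEN iffD1] ext)
      (simp add: poly_char_poly_mat q det_shift_stochastic[OF assms(1), of _ k] M_def
        left_diff_distrib)
  have "det (M 1) \<noteq> 0"
  proof
    assume "det (M 1) = 0"
    then obtain v where v: "v \<noteq> 0" "M 1 *v v = 0" by (auto simp: det_eq_0_iff_kernel)
    \<comment> \<open>Column k of \<open>M 1\<close> is constant 1, so \<open>M 1 *v v\<close> is
      v_k times the constant vector plus (I - P) w.\<close>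
    define w where "w = (\<lambda>j. if j = k then 0 else v $ j)"
    have Mv: "v $ k + w i - (\<Sum>j\<in>UNIV. P $ i $ j * w j) = 0" for i
    proof -
      have "0 = (\<Sum>j\<in>UNIV. M 1 $ i $ j * v $ j)"
        using v(2) by (simp add: vec_eq_iff matrix_vector_mult_def)
      also have "\<dots> = (\<Sum>j\<in>UNIV. (if j = k then v $ k else 0) + (if i = j then w j else 0) - P $ i $ j * w j)"
        by (rule sum.cong) (auto simp: M_def w_def left_diff_distrib)
      finally show ?thesis by (simp add: sum_subtractf sum.distrib)
    qed
    have sp: "(\<Sum>i\<in>UNIV. \<pi> i) = 1" "(\<Sum>i\<in>UNIV. \<pi> i * P $ i $ j) = \<pi> j" for j
      using assms(3) by (auto simp: stationary_def prob_vector_def)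
    \<comment> \<open>Pairing with \<pi> kills (I - P) w, which leaves v_k = 0 and w
      harmonic.\<close>
    have "(\<Sum>i\<in>UNIV. \<pi> i * (\<Sum>j\<in>UNIV. P $ i $ j * w j)) = (\<Sum>j\<in>UNIV. \<pi> j * w j)"
      unfolding sum_distrib_left
      by (subst sum.swap) (simp add: sp(2) flip: mult.assoc sum_distrib_right)
    moreover have "(\<Sum>i\<in>UNIV. \<pi> i * (v $ k + w i - (\<Sum>j\<in>UNIV. P $ i $ j * w j))) = 0"
      by (simp add: Mv)
    ultimately have "v $ k = 0"
      by (simp add: right_diff_distrib distrib_left sum.distrib sum_subtractf sp(1)
          flip: sum_distrib_right)
    then have "(\<Sum>j\<in>UNIV. P $ i $ j * w j) = w i" for i
      using Mv[of i] by simp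
    from harmonic_const[OF assms(1,2) this] have "w i = w k" for i .
    then have "v $ i = 0" for i
      using \<open>v $ k = 0\<close> by (cases "i = k") (simp_all add: w_def, metis)
    with v(1) show False by (simp add: vec_eq_iff)
  qed
  then have "order 1 q = 0" by (intro order_0I) (simp add: q)
  moreover have "order 1 (char_poly_mat P) = order (1 :: real) [:-1, 1:] + order 1 q"
    using char_poly_mat_nonzero[OF assms(1)] unfolding cp by (rule Polynomial.order_mult[of "[:-1, 1:]" q 1])
  ultimately show ?thesis
    using order_power_n_n[of "1::real" 1] by simp
qed

text \<open>1 heads the decreasing list and occurs once, so the next entry is the largest remaining
  root. The root m guarantees that this entry exists; otherwise index 1 would be out of
  range.\<close>

lemma second_eigenvalue_bounds:
  fixes P :: "real^'s::finite^'s"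
  assumes "stochastic P" "irreducible_chain P" "stationary P \<pi>"
    and m: "poly (char_poly_mat P) m = 0" "m < 1"
  shows "m \<le> second_eigenvalue P" "second_eigenvalue P < 1"
proof -
  define M where "M = proots (char_poly_mat P)"
  define L where "L = eigenvalues_desc P"
  note nz = char_poly_mat_nonzero[OF assms(1)]
  have mL: "mset L = M" unfolding L_def M_def eigenvalues_desc_def by simp
  have sL: "sorted_wrt (\<ge>) L"
    unfolding L_def eigenvalues_desc_def sorted_wrt_rev by simp
  have cnt: "count M 1 = 1"
    unfolding M_def using nz order_1_char_poly_mat[OF assms(1-3)] by simp
  have M1: "x \<le> 1" if "x \<in># M" for x
    using that char_poly_mat_root_le_1[OF assms(1)] nz by (auto simp: M_def)
  have mM: "m \<in># M" using m nz by (simp add: M_def)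
  have oneM: "1 \<in># M" using cnt by (metis count_eq_zero_iff zero_neq_one)
  obtain x xs where L: "L = x # xs" using mL mM by (cases L) auto
  have "1 \<le> x" using sL oneM L mL[symmetric] by auto
  with M1 mL L have x: "x = 1" by (metis list.set_intros(1) order_antisym set_mset_mset)
  have xs: "mset xs = M - {#1#}" using mL L x by (metis add_mset_remove_trivial mset.simps(2))
  have "m \<in># mset xs" using mM m(2) by (simp add: xs in_diff_count)
  then obtain y ys where ys: "xs = y # ys" by (cases xs) auto
  have "1 \<notin># mset xs" using cnt by (simp add: xs not_in_iff)
  then have "y \<noteq> 1" by (auto simp: ys)
  moreover have "y \<le> 1" using M1 mL L ys by auto
  moreover have "m \<le> y" using \<open>m \<in># mset xs\<close> sL L ys by auto
  ultimately show "m \<le> second_eigenvalue P" "second_eigenvalue P < 1"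
    unfolding second_eigenvalue_def L_def[symmetric] by (auto simp: L ys)
qed

section \<open>The inner product of L^2(\<pi>) and Rayleigh quotients\<close>

definition ip :: "('s::finite \<Rightarrow> real) \<Rightarrow> ('s \<Rightarrow> real) \<Rightarrow> ('s \<Rightarrow> real) \<Rightarrow> real" where
  "ip \<pi> x y = (\<Sum>i\<in>UNIV. \<pi> i * x i * y i)"

definition app :: "('s::finite \<Rightarrow> 's \<Rightarrow> real) \<Rightarrow> ('s \<Rightarrow> real) \<Rightarrow> 's \<Rightarrow> real" where
  "app K x i = (\<Sum>j\<in>UNIV. K i j * x j)"

lemma ip_commute: "ip \<pi> x y = ip \<pi> y x"
  by (simp add: ip_def mult_ac)

lemma ip_linear:
  "ip \<pi> (\<lambda>i. a * x i + b * y i) z = a * ip \<pi> x z + b * ip \<pi> y z"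
  by (simp add: ip_def sum_distrib_left algebra_simps sum.distrib)

lemma ip_linear_right:
  "ip \<pi> z (\<lambda>i. a * x i + b * y i) = a * ip \<pi> z x + b * ip \<pi> z y"
  by (simp add: ip_def sum_distrib_left algebra_simps sum.distrib)

lemma app_linear:
  "app K (\<lambda>i. a * x i + b * y i) = (\<lambda>i. a * app K x i + b * app K y i)"
  by (rule ext) (simp add: app_def sum_distrib_left algebra_simps sum.distrib)

lemma ip_self_nonneg: "(\<And>i. \<pi> i \<ge> 0) \<Longrightarrow> ip \<pi> x x \<ge> 0"
  by (simp add: ip_def sum_nonneg mult.assoc)

lemma ip_app_symmetric:
  assumes "\<And>i j. \<pi> i * K i j = \<pi> j * K j i"
  shows "ip \<pi> x (app K y) = ip \<pi> (app K x) y"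
proof -
  have "ip \<pi> x (app K y) = (\<Sum>i\<in>UNIV. \<Sum>j\<in>UNIV. \<pi> i * K i j * x i * y j)"
    by (simp add: ip_def app_def sum_distrib_left mult_ac)
  also have "\<dots> = (\<Sum>j\<in>UNIV. \<Sum>i\<in>UNIV. \<pi> i * K i j * x i * y j)"
    by (rule sum.swap)
  also have "\<dots> = ip \<pi> (app K x) y"
    by (simp add: ip_def app_def sum_distrib_left sum_distrib_right assms mult_ac)
  finally show ?thesis .
qed

text \<open>Both coefficients stay explicit; later combinations are written with coefficients such
  as 1 and -1 so that this rewrite rule matches.\<close>

lemma quadratic_form_expand:
  assumes "\<And>i j. \<pi> i * K i j = \<pi> j * K j i"
  shows "ip \<pi> (\<lambda>i. a * x i + b * y i) (app K (\<lambda>i. a * x i + b * y i))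
    = a\<^sup>2 * ip \<pi> x (app K x) + 2 * a * b * ip \<pi> x (app K y) + b\<^sup>2 * ip \<pi> y (app K y)"
  using ip_app_symmetric[of \<pi> K y x, OF assms] ip_commute[of \<pi> "app K y" x]
  by (simp add: app_linear ip_linear ip_linear_right power2_eq_square algebra_simps)

lemma ip_expand:
  "ip \<pi> (\<lambda>i. a * x i + b * y i) (\<lambda>i. a * x i + b * y i)
    = a\<^sup>2 * ip \<pi> x x + 2 * a * b * ip \<pi> x y + b\<^sup>2 * ip \<pi> y y"
  using ip_commute[of \<pi> y x]
  by (simp add: ip_linear ip_linear_right power2_eq_square algebra_simps)

text \<open>First-order condition at an extremum: for small t of sign opposite to b the linear term
  dominates.\<close>

lemma nonneg_quadratic_linear_coeff:
  fixes b q :: real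
  assumes "\<And>t. 2 * t * b + t\<^sup>2 * q \<ge> 0"
  shows "b = 0"
proof (rule ccontr)
  assume b: "b \<noteq> 0"
  define s where "s = 1 / (\<bar>q\<bar> + 1)"
  have s: "s > 0" "s * q < 1" by (auto simp: s_def divide_simps)
  have "0 \<le> 2 * (- (s * b)) * b + (- (s * b))\<^sup>2 * q" by (rule assms)
  also have "\<dots> = (s * b\<^sup>2) * (s * q - 2)" by (simp add: power2_eq_square algebra_simps)
  also have "\<dots> < 0" using s b by (intro mult_pos_neg) auto
  finally show False by simp
qed

text \<open>The Rayleigh quotient attains its maximum m on the compact set of unit vectors
  orthogonal to the constants. This orthogonal complement is invariant under K, so the first
  variation at a maximizer v in the direction m v - K v shows that v is an eigenvector.\<close>

lemma reversible_rayleigh_attained: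
  fixes \<pi> :: "'s::finite \<Rightarrow> real" and K :: "'s \<Rightarrow> 's \<Rightarrow> real"
  assumes card: "CARD('s) \<ge> 2" and pos: "\<And>i. \<pi> i > 0"
    and sym: "\<And>i j. \<pi> i * K i j = \<pi> j * K j i"
    and row: "\<And>i. (\<Sum>j\<in>UNIV. K i j) = 1"
  obtains m v i where "v i \<noteq> 0" "ip \<pi> (\<lambda>_. 1) v = 0" "\<And>i. app K v i = m * v i"
    "\<And>x. ip \<pi> (\<lambda>_. 1) x = 0 \<Longrightarrow> ip \<pi> x (app K x) \<le> m * ip \<pi> x x"
proof -
  let ?e = "\<lambda>_::'s. 1 :: real"
  define T :: "(real^'s) set" where "T = {x. ip \<pi> ?e (($) x) = 0} \<inter> sphere 0 1"
  define R where "R = (\<lambda>x::real^'s. ip \<pi> (($) x) (app K (($) x)) / ip \<pi> (($) x) (($) x))"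
  have ip_pos: "ip \<pi> x x > 0" if "x i \<noteq> 0" for x i
    unfolding ip_def using that pos
    by (intro sum_pos2[of _ i]) (auto simp: mult.assoc less_imp_le zero_less_mult_iff linorder_neq_iff)
  have ipv: "ip \<pi> (($) x) (($) x) > 0" if "x \<noteq> 0" for x :: "real^'s"
    using that ip_pos[of "($) x"] by (auto simp: vec_eq_iff)
  have "compact T"
    unfolding T_def ip_def
    by (intro closed_Int_compact closed_Collect_eq continuous_intros compact_sphere)
  moreover have inT: "(1 / norm x) *\<^sub>R x \<in> T" if "x \<noteq> 0" "ip \<pi> ?e (($) x) = 0" for x :: "real^'s"
    using that by (auto simp: T_def ip_def mult.assoc mult.left_commute[of _ "inverse _"]
        simp flip: sum_divide_distrib)
  have "T \<noteq> {}"
  proof -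
    have "\<exists>i j::'s. i \<noteq> j"
    proof (rule ccontr)
      assume "\<nexists>i j::'s. i \<noteq> j"
      then have "UNIV = {undefined :: 's}" by auto
      then have "CARD('s) = 1" by (metis is_singletonI is_singleton_altdef)
      with card show False by simp
    qed
    then obtain i j :: 's where ij: "i \<noteq> j" by auto
    \<comment> \<open>Two distinct states give a nonzero vector orthogonal to the constants.\<close>
    define x :: "real^'s" where "x = (\<chi> k. (if k = i then \<pi> j else 0) - (if k = j then \<pi> i else 0))"
    have "x $ i \<noteq> 0" using ij pos[of j] by (simp add: x_def)
    then have "x \<noteq> 0" by auto
    moreover have "ip \<pi> ?e (($) x) = 0"
      by (simp add: ip_def x_def right_diff_distrib sum_subtractf if_distrib[of "\<lambda>x. _ * x"] cong: if_cong)
    ultimately show ?thesis using inT by auto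
  qed
  moreover have "continuous_on T R"
    unfolding R_def
  proof (intro continuous_on_divide ballI)
    show "ip \<pi> (($) x) (($) x) \<noteq> 0" if "x \<in> T" for x
      using ipv[of x] that by (cases "x = 0") (auto simp: T_def)
  qed (auto simp: ip_def app_def intro!: continuous_intros)
  ultimately obtain y where y: "y \<in> T" "\<And>x. x \<in> T \<Longrightarrow> R x \<le> R y"
    using continuous_attains_sup[of T R] by auto
  define m where "m = R y"
  define v where "v = ($) y"
  have "y \<noteq> 0" "ip \<pi> ?e v = 0" using y by (auto simp: T_def v_def)
  then obtain i where i: "v i \<noteq> 0" by (auto simp: vec_eq_iff v_def)
  have ray: "ip \<pi> x (app K x) \<le> m * ip \<pi> x x" if "ip \<pi> ?e x = 0" for x
  proof (cases "\<exists>i. x i \<noteq> 0")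
    case True
    define w :: "real^'s" where "w = (\<chi> i. x i)"
    have w: "w \<noteq> 0" "x = ($) w" using True by (auto simp: w_def vec_eq_iff)
    define c where "c = 1 / norm w"
    have "c \<noteq> 0" using w by (simp add: c_def)
    have "R (c *\<^sub>R w) \<le> m"
      unfolding m_def c_def using that w by (intro y inT) auto
    moreover have "R (c *\<^sub>R w) = (c\<^sup>2 * ip \<pi> x (app K x)) / (c\<^sup>2 * ip \<pi> x x)"
      unfolding R_def w(2)
      by (simp add: ip_def app_def sum_distrib_left power2_eq_square mult_ac)
    ultimately show ?thesis
      using \<open>c \<noteq> 0\<close> True ip_pos[of x] by (auto simp: pos_divide_le_eq)
  qed (simp add: ip_def)
  define z where "z = (\<lambda>i. m * v i + (-1) * app K v i)"
  have Ke: "app K ?e = ?e" by (auto simp: app_def row)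
  have "ip \<pi> ?e (app K v) = 0"
    using ip_app_symmetric[of \<pi> K ?e v, OF sym] \<open>ip \<pi> ?e v = 0\<close> by (simp add: Ke)
  then have ze: "ip \<pi> ?e z = 0"
    unfolding z_def ip_linear_right by (simp add: \<open>ip \<pi> ?e v = 0\<close>)
  have veq: "m * ip \<pi> v v - ip \<pi> v (app K v) = 0"
    using ip_pos[of v i, OF i] by (simp add: m_def R_def v_def)
  have "m * ip \<pi> v z - ip \<pi> v (app K z) = 0"
  proof (rule nonneg_quadratic_linear_coeff)
    fix t :: real
    let ?w = "\<lambda>i. 1 * v i + t * z i"
    have "ip \<pi> ?e ?w = 0"
      unfolding ip_linear_right by (simp add: ze \<open>ip \<pi> ?e v = 0\<close>)
    from ray[OF this] show "0 \<le> 2 * t * (m * ip \<pi> v z - ip \<pi> v (app K z))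
        + t\<^sup>2 * (m * ip \<pi> z z - ip \<pi> z (app K z))"
      unfolding ip_expand quadratic_form_expand[of \<pi> K, OF sym] using veq by (simp add: algebra_simps)
  qed
  moreover have "ip \<pi> z z = m * ip \<pi> v z - ip \<pi> (app K v) z"
    unfolding z_def[of, THEN arg_cong[of _ _ "\<lambda>x. ip \<pi> x z"]] ip_linear by simp
  ultimately have "ip \<pi> z z = 0"
    using ip_app_symmetric[of \<pi> K v z, OF sym] by simp
  then have "z i = 0" for i using ip_pos[of z i] by force
  then have "app K v i = m * v i" for i by (simp add: z_def)
  with that i \<open>ip \<pi> ?e v = 0\<close> ray show ?thesis by blast
qed

text \<open>Split x into its mean and a part y orthogonal to the constants. P is self-adjoint and
  fixes the constants, so its form splits too, and on y it is controlled by the maximal Rayleigh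
  quotient m \<le> \<open>second_eigenvalue P\<close>.\<close>

lemma spectral_gap_form:
  fixes P :: "real^'s::finite^'s"
  defines "l \<equiv> max 0 (second_eigenvalue P)"
  assumes card: "CARD('s) \<ge> 2" and st: "stochastic P" and irr: "irreducible_chain P"
    and stat: "stationary P \<pi>" and rev: "reversible P \<pi>"
  shows "l < 1"
    "ip \<pi> x (app (\<lambda>i j. P $ i $ j) x) \<le> l * ip \<pi> x x + (1 - l) * (ip \<pi> (\<lambda>_. 1) x)\<^sup>2"
proof -
  let ?K = "\<lambda>i j. P $ i $ j" and ?e = "\<lambda>_::'s. 1 :: real"
  note pos = stationary_pos[OF st irr stat]
  have sym: "\<pi> i * P $ i $ j = \<pi> j * P $ j $ i" for i j
    using rev by (simp add: reversible_def)
  have row: "(\<Sum>j\<in>UNIV. P $ i $ j) = 1" for i using st by (simp add: stochastic_def)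
  obtain v i m where v: "v i \<noteq> 0" "ip \<pi> ?e v = 0" "\<And>i. app ?K v i = m * v i"
    and ray: "\<And>x. ip \<pi> ?e x = 0 \<Longrightarrow> ip \<pi> x (app ?K x) \<le> m * ip \<pi> x x"
    by (rule reversible_rayleigh_attained[of \<pi> ?K, OF card pos sym row], rule that)
  have root: "poly (char_poly_mat P) m = 0"
    unfolding poly_char_poly_mat_eq_0_iff using v
    by (intro exI[of _ "\<chi> i. v i"]) (auto simp: app_def vec_eq_iff)
  have e1: "ip \<pi> ?e ?e = 1"
    using stat by (simp add: ip_def stationary_def prob_vector_def)
  \<comment> \<open>For eigenvalue 1 the vector v would be harmonic, hence a nonzero constant, which
    is not orthogonal to the constants.\<close>
  have "m \<noteq> 1"
  proof
    assume "m = 1"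
    then have "(\<Sum>j\<in>UNIV. P $ i $ j * v j) = v i" for i using v(3)[of i] by (simp add: app_def)
    then have "v = (\<lambda>_. v i)" by (intro ext harmonic_const[OF st irr])
    moreover have "ip \<pi> ?e (\<lambda>_. c) = c * ip \<pi> ?e ?e" for c
      by (simp add: ip_def sum_distrib_left mult.commute)
    ultimately have "ip \<pi> ?e v = v i * ip \<pi> ?e ?e" by metis
    with v e1 show False by simp
  qed
  with char_poly_mat_root_le_1[OF st root] have "m < 1" by simp
  note sb = second_eigenvalue_bounds[OF st irr stat root this]
  then show "l < 1" by (simp add: l_def)
  have Ke: "app ?K ?e = ?e" by (auto simp: app_def row)
  define c where "c = ip \<pi> ?e x"
  define y where "y = (\<lambda>i. 1 * x i + (-c) * ?e i)"
  have y0: "ip \<pi> ?e y = 0"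
    unfolding y_def ip_linear_right by (simp add: c_def e1)
  have xe: "ip \<pi> x ?e = c" unfolding c_def by (rule ip_commute)
  have q: "ip \<pi> y (app ?K y) = ip \<pi> x (app ?K x) - c\<^sup>2"
    unfolding y_def quadratic_form_expand[of \<pi> ?K, OF sym] xe Ke e1
    by (simp add: power2_eq_square)
  have n: "ip \<pi> y y = ip \<pi> x x - c\<^sup>2"
    unfolding y_def ip_expand e1 xe by (simp add: power2_eq_square)
  have "ip \<pi> y (app ?K y) \<le> m * ip \<pi> y y" by (rule ray[OF y0])
  also have "\<dots> \<le> l * ip \<pi> y y"
    using sb pos by (intro mult_right_mono ip_self_nonneg) (auto simp: l_def less_imp_le)
  finally show "ip \<pi> x (app ?K x) \<le> l * ip \<pi> x x + (1 - l) * (ip \<pi> ?e x)\<^sup>2"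
    unfolding q n by (simp add: algebra_simps flip: c_def)
qed

section \<open>Exponential moments\<close>

text \<open>Since \<open>K\<close> is nonnegative, passing to absolute values bounds the form below by \<open>- \<rho>\<close>;
  polarization applied to \<open>K x\<close> and \<open>\<rho> x\<close> does the rest.\<close>

lemma nonneg_symmetric_contraction:
  assumes pos: "\<And>i. \<pi> i \<ge> 0" and K: "\<And>i j. K i j \<ge> 0"
    and sym: "\<And>i j. \<pi> i * K i j = \<pi> j * K j i"
    and form: "\<And>x. ip \<pi> x (app K x) \<le> \<rho> * ip \<pi> x x" and \<rho>: "\<rho> > 0"
  shows "ip \<pi> (app K x) (app K x) \<le> \<rho>\<^sup>2 * ip \<pi> x x"
proof -
  have lower: "- (\<rho> * ip \<pi> z z) \<le> ip \<pi> z (app K z)" for z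
  proof -
    have "- ip \<pi> z (app K z) \<le> ip \<pi> (\<lambda>i. \<bar>z i\<bar>) (app K (\<lambda>i. \<bar>z i\<bar>))"
      unfolding ip_def app_def sum_distrib_left sum_negf[symmetric]
    proof (intro sum_mono)
      fix i j
      have "- (z i * z j) \<le> \<bar>z i\<bar> * \<bar>z j\<bar>" by (metis abs_ge_minus_self abs_mult)
      then have "(\<pi> i * K i j) * (- (z i * z j)) \<le> (\<pi> i * K i j) * (\<bar>z i\<bar> * \<bar>z j\<bar>)"
        using pos K by (intro mult_left_mono) auto
      then show "- (\<pi> i * z i * (K i j * z j)) \<le> \<pi> i * \<bar>z i\<bar> * (K i j * \<bar>z j\<bar>)"
        by (simp add: mult_ac)
    qed
    also have "\<dots> \<le> \<rho> * ip \<pi> (\<lambda>i. \<bar>z i\<bar>) (\<lambda>i. \<bar>z i\<bar>)" by (rule form)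
    also have "\<dots> = \<rho> * ip \<pi> z z" by (simp add: ip_def mult.assoc)
    finally show ?thesis by simp
  qed
  let ?y = "app K x"
  have "4 * \<rho> * ip \<pi> ?y ?y = ip \<pi> (\<lambda>i. 1 * ?y i + \<rho> * x i) (app K (\<lambda>i. 1 * ?y i + \<rho> * x i))
      - ip \<pi> (\<lambda>i. 1 * ?y i + (- \<rho>) * x i) (app K (\<lambda>i. 1 * ?y i + (- \<rho>) * x i))"
    unfolding quadratic_form_expand[of \<pi> K, OF sym] by simp
  also have "\<dots> \<le> \<rho> * ip \<pi> (\<lambda>i. 1 * ?y i + \<rho> * x i) (\<lambda>i. 1 * ?y i + \<rho> * x i)
      + \<rho> * ip \<pi> (\<lambda>i. 1 * ?y i + (- \<rho>) * x i) (\<lambda>i. 1 * ?y i + (- \<rho>) * x i)"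
    using form[of "\<lambda>i. 1 * ?y i + \<rho> * x i"] lower[of "\<lambda>i. 1 * ?y i + (- \<rho>) * x i"]
    by linarith
  also have "\<dots> = 2 * \<rho> * ip \<pi> ?y ?y + 2 * \<rho> * (\<rho>\<^sup>2 * ip \<pi> x x)"
    unfolding ip_expand by (simp add: algebra_simps)
  finally have "2 * \<rho> * ip \<pi> ?y ?y \<le> 2 * \<rho> * (\<rho>\<^sup>2 * ip \<pi> x x)" by simp
  then show ?thesis using \<rho> by simp
qed

text \<open>Each application of K stretches the norm by at most \<rho>. Cauchy-Schwarz, in the form
  that \<rho>^n x - K^n x has nonnegative square norm, then bounds the matrix element.\<close>

lemma ip_funpow_le:
  assumes pos: "\<And>i. \<pi> i \<ge> 0" and K: "\<And>i j. K i j \<ge> 0"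
    and sym: "\<And>i j. \<pi> i * K i j = \<pi> j * K j i"
    and form: "\<And>x. ip \<pi> x (app K x) \<le> \<rho> * ip \<pi> x x" and \<rho>: "\<rho> > 0"
  shows "ip \<pi> x ((app K ^^ n) x) \<le> \<rho> ^ n * ip \<pi> x x"
proof -
  let ?y = "(app K ^^ n) x"
  have "ip \<pi> ((app K ^^ n) x) ((app K ^^ n) x) \<le> (\<rho> ^ n)\<^sup>2 * ip \<pi> x x"
  proof (induction n)
    case (Suc n)
    have "ip \<pi> ((app K ^^ Suc n) x) ((app K ^^ Suc n) x) \<le> \<rho>\<^sup>2 * ip \<pi> ((app K ^^ n) x) ((app K ^^ n) x)"
      using nonneg_symmetric_contraction[of \<pi> K, OF pos K sym form \<rho>] by simp
    also have "\<dots> \<le> \<rho>\<^sup>2 * ((\<rho> ^ n)\<^sup>2 * ip \<pi> x x)"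
      by (intro mult_left_mono Suc) simp
    finally show ?case by (simp add: power_mult_distrib mult_ac)
  qed simp
  moreover have "0 \<le> ip \<pi> (\<lambda>i. \<rho> ^ n * x i + (-1) * ?y i) (\<lambda>i. \<rho> ^ n * x i + (-1) * ?y i)"
    by (rule ip_self_nonneg[OF pos])
  ultimately have "2 * \<rho> ^ n * ip \<pi> x ?y \<le> 2 * \<rho> ^ n * (\<rho> ^ n * ip \<pi> x x)"
    unfolding ip_expand by (simp add: power2_eq_square mult_ac)
  then show ?thesis using \<rho> by simp
qed

section \<open>Path sums and the Chernoff bound\<close>

lemma sum_length_Suc:
  "(\<Sum>xs\<in>{xs :: 's::finite list. length xs = Suc n}. F xs)
     = (\<Sum>i\<in>UNIV. \<Sum>xs\<in>{xs. length xs = n}. F (i # xs))"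
proof -
  have img: "{xs :: 's list. length xs = Suc n} = (\<lambda>(i, xs). i # xs) ` (UNIV \<times> {xs. length xs = n})"
    by (auto simp: length_Suc_conv)
  have inj: "inj_on (\<lambda>(i, xs). i # xs) (UNIV \<times> {xs :: 's list. length xs = n})"
    by (auto intro!: inj_onI)
  show ?thesis
    unfolding img sum.reindex[OF inj] by (simp add: sum.cartesian_product case_prod_beta o_def)
qed

text \<open>With initial weight 1, \<open>path_prob\<close> is the plain product of transition
  probabilities, so paths can be peeled from the front.\<close>

lemma path_prob_Cons_Cons:
  "path_prob P \<pi> (i # j # xs) = \<pi> i * P $ i $ j * path_prob P (\<lambda>_. 1) (j # xs)"
  by (simp add: path_prob_def prod.lessThan_Suc_shift del: prod.lessThan_Suc)

text \<open>Half of each weight \<open>(s i)\<^sup>2\<close> goes to either side of \<open>P\<close>, which keeps the kernel self-adjoint.\<close>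

lemma tilted_path_sum_from:
  fixes P :: "real^'s::finite^'s" and s :: "'s \<Rightarrow> real"
  defines "K \<equiv> \<lambda>i j. s i * P $ i $ j * s j"
  shows "(\<Sum>xs\<in>{xs. length xs = n}. path_prob P (\<lambda>_. 1) (i # xs) * (\<Prod>k<Suc n. (s ((i # xs) ! k))\<^sup>2))
     = s i * (app K ^^ n) s i"
proof (induction n arbitrary: i)
  case 0
  show ?case by (simp add: path_prob_def power2_eq_square)
next
  case (Suc n)
  have "(\<Sum>xs\<in>{xs. length xs = Suc n}. path_prob P (\<lambda>_. 1) (i # xs) * (\<Prod>k<Suc (Suc n). (s ((i # xs) ! k))\<^sup>2))
     = (\<Sum>j\<in>UNIV. \<Sum>xs\<in>{xs. length xs = n}. (s i)\<^sup>2 * P $ i $ j *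
          (path_prob P (\<lambda>_. 1) (j # xs) * (\<Prod>k<Suc n. (s ((j # xs) ! k))\<^sup>2)))"
    unfolding sum_length_Suc path_prob_Cons_Cons
    by (simp only: prod.lessThan_Suc_shift[of _ "Suc n"]) (simp add: mult_ac)
  also have "\<dots> = (\<Sum>j\<in>UNIV. (s i)\<^sup>2 * P $ i $ j * (s j * (app K ^^ n) s j))"
    by (simp only: Suc flip: sum_distrib_left)
  also have "\<dots> = s i * (app K ^^ Suc n) s i"
    by (simp add: app_def K_def sum_distrib_left power2_eq_square mult_ac)
  finally show ?case .
qed

text \<open>A path of n + 1 states has n transitions, hence the n-th iterate; the half weights left
  over at the two ends are the two outer occurrences of s.\<close>

lemma tilted_path_sum:
  fixes P :: "real^'s::finite^'s" and s :: "'s \<Rightarrow> real"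
  defines "K \<equiv> \<lambda>i j. s i * P $ i $ j * s j"
  shows "(\<Sum>xs\<in>{xs. length xs = Suc n}. path_prob P \<pi> xs * (\<Prod>k<Suc n. (s (xs ! k))\<^sup>2))
     = ip \<pi> s ((app K ^^ n) s)"
proof -
  have pp: "path_prob P \<pi> (i # xs) = \<pi> i * path_prob P (\<lambda>_. 1) (i # xs)" for i xs
    by (simp add: path_prob_def)
  show ?thesis
    unfolding sum_length_Suc pp mult.assoc
    unfolding K_def ip_def sum_distrib_left[symmetric] tilted_path_sum_from mult.assoc ..
qed

text \<open>Markov's inequality for the exponential of \<theta> times the path sum, whose mean is a
  matrix element by \<open>tilted_path_sum\<close>.\<close>

lemma path_event_prob_Chernoff:
  fixes P :: "real^'s::finite^'s" and \<pi> f :: "'s \<Rightarrow> real" and c \<theta> :: real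
  assumes "stochastic P" "\<And>i. \<pi> i \<ge> 0" "\<theta> \<ge> 0"
  defines "s \<equiv> \<lambda>i. exp (\<theta> * f i / 2)"
  shows "path_event_prob P \<pi> (Suc n) (\<lambda>xs. (\<Sum>k<Suc n. f (xs ! k)) \<ge> c)
     \<le> exp (- \<theta> * c) * ip \<pi> s ((app (\<lambda>i j. s i * P $ i $ j * s j) ^^ n) s)"
proof -
  have nn: "path_prob P \<pi> xs \<ge> 0" for xs
    using assms by (auto simp: path_prob_def stochastic_def intro!: mult_nonneg_nonneg prod_nonneg)
  have fin: "finite {xs :: 's list. length xs = Suc n}"
    using finite_lists_length_eq[of "UNIV :: 's set" "Suc n"] by simp
  have ss: "(\<Prod>k<Suc n. (s (xs ! k))\<^sup>2) = exp (\<theta> * (\<Sum>k<Suc n. f (xs ! k)))" for xs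
    unfolding s_def sum_distrib_left exp_sum[OF finite_lessThan]
    by (simp add: power2_eq_square flip: exp_add)
  have "path_event_prob P \<pi> (Suc n) (\<lambda>xs. (\<Sum>k<Suc n. f (xs ! k)) \<ge> c)
     \<le> (\<Sum>xs\<in>{xs. length xs = Suc n \<and> (\<Sum>k<Suc n. f (xs ! k)) \<ge> c}.
          exp (- \<theta> * c) * (path_prob P \<pi> xs * (\<Prod>k<Suc n. (s (xs ! k))\<^sup>2)))"
    unfolding path_event_prob_def
  proof (rule sum_mono)
    fix xs assume "xs \<in> {xs. length xs = Suc n \<and> (\<Sum>k<Suc n. f (xs ! k)) \<ge> c}"
    then have "\<theta> * c \<le> \<theta> * (\<Sum>k<Suc n. f (xs ! k))"
      using assms by (intro mult_left_mono) auto
    then have "1 \<le> exp (- \<theta> * c) * exp (\<theta> * (\<Sum>k<Suc n. f (xs ! k)))"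
      by (simp flip: exp_add)
    from mult_left_mono[OF this nn[of xs]]
    show "path_prob P \<pi> xs \<le> exp (- \<theta> * c) * (path_prob P \<pi> xs * (\<Prod>k<Suc n. (s (xs ! k))\<^sup>2))"
      unfolding ss by (simp add: mult_ac)
  qed
  also have "\<dots> \<le> (\<Sum>xs\<in>{xs. length xs = Suc n}.
          exp (- \<theta> * c) * (path_prob P \<pi> xs * (\<Prod>k<Suc n. (s (xs ! k))\<^sup>2)))"
    using nn fin by (intro sum_mono2) (auto intro!: mult_nonneg_nonneg prod_nonneg)
  also have "\<dots> = exp (- \<theta> * c) * ip \<pi> s ((app (\<lambda>i j. s i * P $ i $ j * s j) ^^ n) s)"
    by (simp only: tilted_path_sum flip: sum_distrib_left)
  finally show ?thesis .
qed

section \<open>The form bound for the tilted kernel\<close>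

lemma convex_chord_div:
  fixes a b l \<rho> x :: real
  assumes "0 \<le> x" "x \<le> 1" "0 \<le> l" "0 < \<rho>" "l * a < \<rho>" "l * b < \<rho>"
  defines "y \<equiv> (1 - x) * a + x * b"
  shows "y / (\<rho> - l * y) \<le> (1 - x) * (a / (\<rho> - l * a)) + x * (b / (\<rho> - l * b))"
proof -
  define A B where "A = \<rho> - l * a" and "B = \<rho> - l * b"
  have AB: "A > 0" "B > 0" using assms by (auto simp: A_def B_def)
  define Y where "Y = (1 - x) * A + x * B"
  have Yeq: "Y = \<rho> - l * y" by (simp add: Y_def A_def B_def y_def algebra_simps)
  have Y: "Y > 0"
    using AB assms by (cases "x = 0") (auto simp: Y_def intro: add_nonneg_pos)
  \<comment> \<open>Convexity made explicit: after clearing denominators the gap is x (1 - x) \<rho>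
    l (a - b)^2.\<close>
  have "(1 - x) * a * B * Y + x * b * A * Y - y * A * B = x * (1 - x) * (a * B - b * A) * (B - A)"
    unfolding Y_def y_def by algebra
  also have "a * B - b * A = \<rho> * (a - b)" by (simp add: A_def B_def algebra_simps)
  also have "B - A = l * (a - b)" by (simp add: A_def B_def algebra_simps)
  also have "x * (1 - x) * (\<rho> * (a - b)) * (l * (a - b)) = x * (1 - x) * \<rho> * l * (a - b)\<^sup>2"
    by (simp add: power2_eq_square mult_ac)
  also have "\<dots> \<ge> 0" using assms by simp
  finally have "y * A * B \<le> (1 - x) * a * B * Y + x * b * A * Y" by simp
  then have "y / Y \<le> ((1 - x) * a * B + x * b * A) / (A * B)"
    using AB Y by (simp add: divide_simps algebra_simps)
  also have "\<dots> = (1 - x) * (a / A) + x * (b / B)"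
    using AB by (simp add: field_simps)
  finally show ?thesis by (simp add: Yeq A_def B_def)
qed

text \<open>Both claims follow from \<open>key\<close>, a Cauchy-Schwarz estimate with weights
  \<rho> - l s^2 that needs (1 - l) C \<le> 1. The bound on C is its value for a {0, 1}-valued f of
  the same mean, where \<open>char\<close> applies.\<close>

lemma tilted_form_le:
  fixes P :: "real^'s::finite^'s" and \<pi> f :: "'s \<Rightarrow> real"
  assumes pos: "\<And>i. \<pi> i > 0" and sum1: "(\<Sum>i\<in>UNIV. \<pi> i) = 1"
    and f: "\<And>i. 0 \<le> f i \<and> f i \<le> 1" and \<mu>: "\<mu> = (\<Sum>i\<in>UNIV. \<pi> i * f i)"
    and l: "0 \<le> l" "l < 1"
    and form: "\<And>x. ip \<pi> x (app (\<lambda>i j. P $ i $ j) x) \<le> l * ip \<pi> x x + (1 - l) * (ip \<pi> (\<lambda>_. 1) x)\<^sup>2"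
    and \<theta>: "0 \<le> \<theta>" and \<rho>: "l * exp \<theta> < \<rho>" "0 < \<rho>"
    and char: "(1 - l) * ((1 - \<mu>) * (1 / (\<rho> - l)) + \<mu> * (exp \<theta> / (\<rho> - l * exp \<theta>))) \<le> 1"
  defines "s \<equiv> \<lambda>i. exp (\<theta> * f i / 2)"
  shows "ip \<pi> x (app (\<lambda>i j. s i * P $ i $ j * s j) x) \<le> \<rho> * ip \<pi> x x" "ip \<pi> s s \<le> \<rho>"
proof -
  let ?t = "exp \<theta>"
  have s2: "(s i)\<^sup>2 = exp (\<theta> * f i)" for i
    by (simp add: s_def power2_eq_square flip: exp_add)
  have sb: "1 \<le> (s i)\<^sup>2" "(s i)\<^sup>2 \<le> ?t" for i
    using f[of i] \<theta> by (auto simp: s2 mult_left_le)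
  have lt: "l * (s i)\<^sup>2 < \<rho>" for i
    using mult_left_mono[OF sb(2) l(1), of i] \<rho> by linarith
  have s_pos: "s i > 0" for i by (simp add: s_def)
  \<comment> \<open>s^2 lies below the chord y of the exponential, and y / (\<rho> - l y) is
    increasing and convex, so the quotient lies below its chord between f = 0 and f = 1.\<close>
  have frac: "(s i)\<^sup>2 / (\<rho> - l * (s i)\<^sup>2) \<le> (1 - f i) * (1 / (\<rho> - l)) + f i * (?t / (\<rho> - l * ?t))" for i
  proof -
    define y where "y = (1 - f i) * 1 + f i * ?t"
    have fi: "0 \<le> f i" "f i \<le> 1" using f by auto
    have "(s i)\<^sup>2 \<le> y"
      using convex_onD[OF exp_convex, of "f i" 0 \<theta>] fi by (simp add: s2 y_def mult.commute)
    moreover have "y \<le> ?t"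
      using fi \<theta> mult_left_mono[of 1 ?t "1 - f i"] by (simp add: y_def algebra_simps)
    then have "l * y < \<rho>" using mult_left_mono[of y ?t l] l \<rho> by linarith
    ultimately have "(s i)\<^sup>2 / (\<rho> - l * (s i)\<^sup>2) \<le> y / (\<rho> - l * y)"
      using sb(1)[of i] lt[of i] l by (intro frac_le) (auto intro: mult_left_mono)
    also have "\<dots> \<le> (1 - f i) * (1 / (\<rho> - l * 1)) + f i * (?t / (\<rho> - l * ?t))"
      unfolding y_def using lt[of i] mult_left_mono[OF sb(1)[of i] l(1)]
      by (intro convex_chord_div fi l \<rho>) auto
    finally show ?thesis by simp
  qed
  define C where "C = (\<Sum>i\<in>UNIV. \<pi> i * ((s i)\<^sup>2 / (\<rho> - l * (s i)\<^sup>2)))"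
  have "C \<le> (\<Sum>i\<in>UNIV. \<pi> i * ((1 - f i) * (1 / (\<rho> - l)) + f i * (?t / (\<rho> - l * ?t))))"
    unfolding C_def using pos frac by (intro sum_mono mult_left_mono) (auto simp: less_imp_le)
  also have "\<dots> = (\<Sum>i\<in>UNIV. (\<pi> i - \<pi> i * f i) * (1 / (\<rho> - l)) + (\<pi> i * f i) * (?t / (\<rho> - l * ?t)))"
    by (rule sum.cong) (simp_all only: distrib_left left_diff_distrib right_diff_distrib mult.assoc mult_1_left mult_1_right)
  also have "\<dots> = (1 - \<mu>) * (1 / (\<rho> - l)) + \<mu> * (?t / (\<rho> - l * ?t))"
    unfolding sum.distrib sum_distrib_right[symmetric] sum_subtractf sum1 \<mu> ..
  finally have "(1 - l) * C \<le> (1 - l) * ((1 - \<mu>) * (1 / (\<rho> - l)) + \<mu> * (?t / (\<rho> - l * ?t)))"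
    using l by (intro mult_left_mono) auto
  with char have C: "(1 - l) * C \<le> 1" by linarith
  have key: "l * (\<Sum>i\<in>UNIV. \<pi> i * (s i)\<^sup>2 * (x i)\<^sup>2) + (1 - l) * (\<Sum>i\<in>UNIV. \<pi> i * (s i * x i))\<^sup>2
      \<le> \<rho> * ip \<pi> x x" for x
  proof -
    define D where "D = (\<Sum>i\<in>UNIV. \<pi> i * (\<rho> - l * (s i)\<^sup>2) * (x i)\<^sup>2)"
    have D: "D \<ge> 0" unfolding D_def using pos lt by (intro sum_nonneg) (auto simp: less_imp_le)
    have "(\<Sum>i\<in>UNIV. \<pi> i * (s i * x i))\<^sup>2
        = (\<Sum>i\<in>UNIV. (sqrt (\<pi> i / (\<rho> - l * (s i)\<^sup>2)) * s i) * (sqrt (\<pi> i * (\<rho> - l * (s i)\<^sup>2)) * x i))\<^sup>2"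
    proof (rule arg_cong[of _ _ "\<lambda>x. x\<^sup>2"], rule sum.cong)
      fix i
      have "sqrt (\<pi> i / (\<rho> - l * (s i)\<^sup>2)) * sqrt (\<pi> i * (\<rho> - l * (s i)\<^sup>2)) = \<pi> i"
        using pos[of i] lt[of i] by (simp add: power2_eq_square flip: real_sqrt_mult)
      then show "\<pi> i * (s i * x i) = (sqrt (\<pi> i / (\<rho> - l * (s i)\<^sup>2)) * s i) * (sqrt (\<pi> i * (\<rho> - l * (s i)\<^sup>2)) * x i)"
        by (metis (no_types, lifting) mult.assoc mult.commute)
    qed simp
    also have "\<dots> \<le> (\<Sum>i\<in>UNIV. (sqrt (\<pi> i / (\<rho> - l * (s i)\<^sup>2)) * s i)\<^sup>2)
        * (\<Sum>i\<in>UNIV. (sqrt (\<pi> i * (\<rho> - l * (s i)\<^sup>2)) * x i)\<^sup>2)"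
      by (rule Cauchy_Schwarz_ineq_sum)
    also have "\<dots> = C * D"
      unfolding C_def D_def power_mult_distrib using pos lt by (simp add: less_imp_le)
    finally have "(1 - l) * (\<Sum>i\<in>UNIV. \<pi> i * (s i * x i))\<^sup>2 \<le> (1 - l) * (C * D)"
      using l by (intro mult_left_mono) auto
    also have "\<dots> \<le> D" using mult_right_mono[OF C D] by (simp add: mult.assoc)
    also have "D = \<rho> * ip \<pi> x x - l * (\<Sum>i\<in>UNIV. \<pi> i * (s i)\<^sup>2 * (x i)\<^sup>2)"
      unfolding D_def ip_def sum_distrib_left sum_subtractf[symmetric]
      by (rule sum.cong) (auto simp: algebra_simps power2_eq_square)
    finally show ?thesis by simp
  qed
  have "ip \<pi> x (app (\<lambda>i j. s i * P $ i $ j * s j) x)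
      = ip \<pi> (\<lambda>i. s i * x i) (app (\<lambda>i j. P $ i $ j) (\<lambda>i. s i * x i))"
    by (simp add: ip_def app_def sum_distrib_left mult_ac)
  also have "\<dots> \<le> l * ip \<pi> (\<lambda>i. s i * x i) (\<lambda>i. s i * x i) + (1 - l) * (ip \<pi> (\<lambda>_. 1) (\<lambda>i. s i * x i))\<^sup>2"
    by (rule form)
  also have "\<dots> = l * (\<Sum>i\<in>UNIV. \<pi> i * (s i)\<^sup>2 * (x i)\<^sup>2) + (1 - l) * (\<Sum>i\<in>UNIV. \<pi> i * (s i * x i))\<^sup>2"
    by (simp add: ip_def power2_eq_square mult_ac)
  also have "\<dots> \<le> \<rho> * ip \<pi> x x" by (rule key)
  finally show "ip \<pi> x (app (\<lambda>i j. s i * P $ i $ j * s j) x) \<le> \<rho> * ip \<pi> x x" .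
  \<comment> \<open>Here \<open>key\<close> is used at x = s; with Cauchy-Schwarz for the
    probability vector \<pi> it gives e^2 \<le> \<rho> e.\<close>
  define e where "e = ip \<pi> s s"
  have e: "e = (\<Sum>i\<in>UNIV. \<pi> i * (s i)\<^sup>2)" by (simp add: e_def ip_def power2_eq_square mult.assoc)
  have "e\<^sup>2 = (\<Sum>i\<in>UNIV. sqrt (\<pi> i) * (sqrt (\<pi> i) * (s i)\<^sup>2))\<^sup>2"
    unfolding e using pos by (simp add: less_imp_le flip: mult.assoc)
  also have "\<dots> \<le> (\<Sum>i\<in>UNIV. (sqrt (\<pi> i))\<^sup>2) * (\<Sum>i\<in>UNIV. (sqrt (\<pi> i) * (s i)\<^sup>2)\<^sup>2)"
    by (rule Cauchy_Schwarz_ineq_sum)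
  also have "\<dots> = (\<Sum>i\<in>UNIV. \<pi> i * (s i)\<^sup>2 * (s i)\<^sup>2)"
    using pos by (simp add: less_imp_le power_mult_distrib sum1)
      (simp add: power4_eq_xxxx power2_eq_square mult_ac)
  finally have "l * e\<^sup>2 + (1 - l) * e\<^sup>2
      \<le> l * (\<Sum>i\<in>UNIV. \<pi> i * (s i)\<^sup>2 * (s i)\<^sup>2) + (1 - l) * e\<^sup>2"
    using l by (intro add_right_mono mult_left_mono)
  also have "\<dots> \<le> \<rho> * e"
    using key[of s] by (simp add: e_def[symmetric]) (simp add: e power2_eq_square)
  finally have "e * e \<le> \<rho> * e" by (simp add: algebra_simps power2_eq_square)
  moreover have "e > 0" unfolding e by (intro sum_pos mult_pos_pos zero_less_power pos s_pos) auto
  ultimately show "ip \<pi> s s \<le> \<rho>" by (simp add: e_def)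
qed

text \<open>n observations involve only n - 1 applications of the tilted kernel; the missing factor
  \<rho> comes from the bound on \<open>ip \<pi> s s\<close>.\<close>

lemma path_event_prob_le:
  fixes P :: "real^'s::finite^'s" and \<pi> f :: "'s \<Rightarrow> real"
  assumes st: "stochastic P" and rev: "reversible P \<pi>"
    and pos: "\<And>i. \<pi> i > 0" and sum1: "(\<Sum>i\<in>UNIV. \<pi> i) = 1"
    and f: "\<And>i. 0 \<le> f i \<and> f i \<le> 1" and \<mu>: "\<mu> = (\<Sum>i\<in>UNIV. \<pi> i * f i)"
    and l: "0 \<le> l" "l < 1"
    and form: "\<And>x. ip \<pi> x (app (\<lambda>i j. P $ i $ j) x) \<le> l * ip \<pi> x x + (1 - l) * (ip \<pi> (\<lambda>_. 1) x)\<^sup>2"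
    and \<theta>: "0 \<le> \<theta>" and \<rho>: "l * exp \<theta> < \<rho>" "0 < \<rho>"
    and char: "(1 - l) * ((1 - \<mu>) * (1 / (\<rho> - l)) + \<mu> * (exp \<theta> / (\<rho> - l * exp \<theta>))) \<le> 1"
    and n: "n \<ge> 1"
  shows "path_event_prob P \<pi> n (\<lambda>xs. (\<Sum>k<n. f (xs ! k)) \<ge> c) \<le> exp (- \<theta> * c) * \<rho> ^ n"
proof -
  obtain k where k: "n = Suc k" using n by (cases n) auto
  define s where "s = (\<lambda>i. exp (\<theta> * f i / 2))"
  have s_eq: "exp (\<theta> * f i / 2) = s i" for i by (simp add: s_def)
  let ?K = "\<lambda>i j. s i * P $ i $ j * s j"
  note tf = tilted_form_le[OF pos sum1 f \<mu> l form \<theta> \<rho> char, unfolded s_eq]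
  have "ip \<pi> s ((app ?K ^^ k) s) \<le> \<rho> ^ k * ip \<pi> s s"
  proof (rule ip_funpow_le[where K = ?K, OF _ _ _ tf(1) \<rho>(2)])
    show "\<pi> i * ?K i j = \<pi> j * ?K j i" for i j
      using rev unfolding reversible_def by (metis (no_types, lifting) mult.assoc mult.commute)
  qed (use pos st in \<open>auto simp: less_imp_le stochastic_def s_def\<close>)
  also have "\<dots> \<le> \<rho> ^ k * \<rho>" using tf(2) \<rho> by (intro mult_left_mono) auto
  finally have "exp (- \<theta> * c) * ip \<pi> s ((app ?K ^^ k) s) \<le> exp (- \<theta> * c) * \<rho> ^ n"
    by (simp add: k mult.commute)
  then show ?thesis
    using path_event_prob_Chernoff[where P = P and \<pi> = \<pi> and \<theta> = \<theta> and n = k and f = f and c = c, unfolded s_eq] st pos \<theta>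
    by (auto simp: k less_imp_le intro: order_trans)
qed

section \<open>The tail bound\<close>

theorem theorem1:
  fixes P :: "real^'s::finite^'s" and \<pi> :: "'s \<Rightarrow> real" and f :: "'s \<Rightarrow> real"
    and \<epsilon> :: real and n :: nat
  assumes two_states: "CARD('s) \<ge> 2"
    and stoch: "stochastic P"
    and irred: "irreducible_chain P"
    and aper: "aperiodic_chain P"
    and stat: "stationary P \<pi>"
    and rev: "reversible P \<pi>"
    and f_range: "\<forall>i. 0 \<le> f i \<and> f i \<le> 1"
    and mu_pos: "0 < (\<Sum>i\<in>UNIV. \<pi> i * f i)"
    and mu_lt1: "(\<Sum>i\<in>UNIV. \<pi> i * f i) < 1"
    and eps_pos: "\<epsilon> > 0"
    and eps_bd: "(\<Sum>i\<in>UNIV. \<pi> i * f i) + \<epsilon> < 1"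
    and n_pos: "n \<ge> 1"
  shows
    "let \<mu> = (\<Sum>i\<in>UNIV. \<pi> i * f i); mub = 1 - \<mu>;
         lam0 = max 0 (second_eigenvalue P);
         \<Delta> = 1 + 4 * lam0 * (\<mu> + \<epsilon>) * (mub - \<epsilon>) / (\<mu> * mub * (1 - lam0)\<^sup>2);
         B = ((\<mu> + mub * lam0) / (1 - 2 * (mub - \<epsilon>) / (1 + sqrt \<Delta>))) powr (real n * (\<mu> + \<epsilon>))
           * ((mub + \<mu> * lam0) / (1 - 2 * (\<mu> + \<epsilon>) / (1 + sqrt \<Delta>))) powr (real n * (mub - \<epsilon>))
     in path_event_prob P \<pi> n (\<lambda>xs. (\<Sum>k<n. f (xs ! k)) \<ge> real n * (\<mu> + \<epsilon>)) \<le> B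
        \<and> B \<le> exp (- 2 * ((1 - lam0) / (1 + lam0)) * real n * \<epsilon>\<^sup>2)"
proof -
  define \<mu> where "\<mu> = (\<Sum>i\<in>UNIV. \<pi> i * f i)"
  define l where "l = max 0 (second_eigenvalue P)"
  note gap = spectral_gap_form[OF two_states stoch irred stat rev, folded l_def]
  \<comment> \<open>With a = \<mu> + \<epsilon>, \<open>s\<close> is the square root of \<Delta>,
    and X and Y are the two bracketed quotients of the bound.\<close>
  interpret two_state_tilt \<mu> "\<mu> + \<epsilon>" l
    using mu_pos eps_pos eps_bd gap(1) by unfold_locales (auto simp: \<mu>_def l_def)
  define B where "B = X powr (real n * (\<mu> + \<epsilon>)) * Y powr (real n * (1 - (\<mu> + \<epsilon>)))"
  have "path_event_prob P \<pi> n (\<lambda>xs. (\<Sum>k<n. f (xs ! k)) \<ge> real n * (\<mu> + \<epsilon>))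
      \<le> exp (- ln (Y / X) * (real n * (\<mu> + \<epsilon>))) * Y ^ n"
    using stat f_range X_Y_pos tilt_condition
    by (intro path_event_prob_le[OF stoch rev _ _ _ \<mu>_def l gap(2)] stationary_pos[OF stoch irred stat] n_pos)
      (auto simp: stationary_def prob_vector_def)
  also have "\<dots> = B" unfolding B_def by (rule tilt_condition)
  finally have "path_event_prob P \<pi> n (\<lambda>xs. (\<Sum>k<n. f (xs ! k)) \<ge> real n * (\<mu> + \<epsilon>)) \<le> B" .
  moreover have "B \<le> exp (- 2 * ((1 - l) / (1 + l)) * real n * \<epsilon>\<^sup>2)"
    unfolding B_def using powr_bound_le_exp[of n] by simp
  moreover have "1 - \<mu> - \<epsilon> = 1 - (\<mu> + \<epsilon>)" by simp
  ultimately show ?thesis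
    unfolding Let_def \<mu>_def[symmetric] l_def[symmetric]
    by (simp only: B_def X_def Y_def p00_def p11_def q01_def q10_def s_def simp_thms)
qed

end
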